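(* Let $0<\alpha<\beta<1$ be fixed. Suppose that the quantile function $H_F^{-1}$ is continuous at the points $\alpha$ and $\beta$. If $\sigma_g^2>0$, then, as $n\to\infty$, $$\frac{\sqrt n}{m}\bigl((\beta-\alpha)\,U_{\alpha\beta}-\theta\bigr)\ \stackrel{d}{\longrightarrow}\ \tau_g ,$$ where $\tau_g$ is a Gaussian random variable with mean zero and variance $\sigma_g^2$.
   Context: Let $X,X_1,X_2,\ldots$ be i.i.d. random variables with values in a measurable space $(\mathsf X,\mathcal B(\mathsf X))$ with common distribution $F$. Let $m\ge 1$ be a fixed integer, let $h:\mathsf X^m\to\mathbb R$ be a symmetric (measurable) function, and let $H_F$ be the (right-continuous) distribution function of $h(X_1,\ldots,X_m)$. Its left-continuous quantile function is $H_F^{-1}(t)=\inf\{y\in\mathbb R:H_F(y)\ge t\}$, $0<t\le 1$. For $n\ge m$ let $N=\binom{n}{m}$, let $h_1,\ldots,h_N$ be an enumeration of the values $h(X_{i_1},\ldots,X_{i_m})$ over all $1\le i_1<\cdots<i_m\le n$, and let $h_{n1}\le\cdots\le h_{nN}$ be the ordered values of $h_1,\ldots,h_N$. $[a]$ denotes the largest integer $\le a$; $I\{A\}$ denotes the indicator of $A$. For $0<\gamma<1$ put $N_\gamma=[\gamma N]$, and put $N_{\alpha\beta}=N_\beta-N_\alpha$. The trimmed $U$-statistic is $$U_{\alpha\beta}=N_{\alpha\beta}^{-1}\sum_{i=N_\alpha+1}^{N_\beta}h_{ni}.$$ Let $\xi_\gamma^-=\inf\{x\in\mathbb R: H_F(x)\ge\gamma\}$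 and $\xi_\gamma^+=\sup\{x\in\mathbb R: H_F(x)\le\gamma\}$ for $\gamma\in\{\alpha,\beta\}$. Let $$\theta=\int_{\mathbb R}\Bigl[\bigl((x-\xi^-_\beta)I\{x\le\xi^-_\beta\}+\beta\xi^-_\beta\bigr)-\bigl((x-\xi^+_\alpha)I\{x<\xi^+_\alpha\}+\alpha\xi^+_\alpha\bigr)\Bigr]\,\mathrm dH_F(x),$$ and for $x\in\mathsf X$, writing $h(x,\cdot)=h(x,X_2,\ldots,X_m)$, $$g(x)=\bigl[E\,I\{h(x,\cdot)\le\xi^-_\beta\}(h(x,\cdot)-\xi^-_\beta)+\beta\xi^-_\beta\bigr]-\bigl[E\,I\{h(x,\cdot)<\xi^+_\alpha\}(h(x,\cdot)-\xi^+_\alpha)+\alpha\xi^+_\alpha\bigr]-\theta.$$ Finally $\sigma_g^2=Eg^2(X)$. *)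

theory Defs
  imports "HOL-Probability.Probability" "HOL-Combinatorics.Permutations"
begin

text \<open>
  A kernel of degree \<open>m\<close> on the measurable space \<open>S\<close> is a function on \<open>S\<^sup>m\<close>, whose points are
  the extensional functions on \<open>{1..m}\<close>, that is, the points of \<open>\<Pi>\<^sub>M j\<in>{1..m}. S\<close>.
\<close>

definition symmetric_kernel :: "'a measure \<Rightarrow> nat \<Rightarrow> ((nat \<Rightarrow> 'a) \<Rightarrow> real) \<Rightarrow> bool" where
  "symmetric_kernel S m h \<longleftrightarrow>
     (\<forall>\<pi> x. \<pi> permutes {1..m} \<longrightarrow> x \<in> space (\<Pi>\<^sub>M j\<in>{1..m}. S) \<longrightarrow>
        h (\<lambda>j\<in>{1..m}. x (\<pi> j)) = h x)"

definition kernel_cdf :: "'b measure \<Rightarrow> (nat \<Rightarrow> 'b \<Rightarrow> 'a) \<Rightarrow> nat \<Rightarrow> ((nat \<Rightarrow> 'a) \<Rightarrow> real) \<Rightarrow> real \<Rightarrow> real" where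
  "kernel_cdf M X m h = cdf (distr M borel (\<lambda>\<omega>. h (\<lambda>j\<in>{1..m}. X j \<omega>)))"

definition quantile :: "(real \<Rightarrow> real) \<Rightarrow> real \<Rightarrow> real" where
  "quantile H t = Inf {y. H y \<ge> t}"

definition xi_minus :: "(real \<Rightarrow> real) \<Rightarrow> real \<Rightarrow> real" where
  "xi_minus H \<gamma> = Inf {x. H x \<ge> \<gamma>}"

definition xi_plus :: "(real \<Rightarrow> real) \<Rightarrow> real \<Rightarrow> real" where
  "xi_plus H \<gamma> = Sup {x. H x \<le> \<gamma>}"

text \<open>
  For \<open>I = {i\<^sub>1 < \<dots> < i\<^sub>m}\<close>, \<open>kernel_value m h x I\<close> is \<open>h(x\<^bsub>i\<^sub>1\<^esub>, \<dots>, x\<^bsub>i\<^sub>m\<^esub>)\<close>; lists are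
  indexed from 0, hence the shift.
\<close>

definition kernel_value :: "nat \<Rightarrow> ((nat \<Rightarrow> 'a) \<Rightarrow> real) \<Rightarrow> (nat \<Rightarrow> 'a) \<Rightarrow> nat set \<Rightarrow> real" where
  "kernel_value m h x I = h (\<lambda>j\<in>{1..m}. x (sorted_list_of_set I ! (j - 1)))"

definition ordered_values :: "nat \<Rightarrow> ((nat \<Rightarrow> 'a) \<Rightarrow> real) \<Rightarrow> (nat \<Rightarrow> 'a) \<Rightarrow> nat \<Rightarrow> real list" where
  "ordered_values m h x n =
     sorted_list_of_multiset
       (image_mset (kernel_value m h x) (mset_set {I. I \<subseteq> {1..n} \<and> card I = m}))"

definition trim_index :: "nat \<Rightarrow> nat \<Rightarrow> real \<Rightarrow> nat" where
  "trim_index m n \<gamma> = nat \<lfloor>\<gamma> * real (n choose m)\<rfloor>"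

definition trimmed_U :: "nat \<Rightarrow> ((nat \<Rightarrow> 'a) \<Rightarrow> real) \<Rightarrow> real \<Rightarrow> real \<Rightarrow> nat \<Rightarrow> (nat \<Rightarrow> 'a) \<Rightarrow> real" where
  "trimmed_U m h \<alpha> \<beta> n x =
     (\<Sum>i = trim_index m n \<alpha> + 1..trim_index m n \<beta>. ordered_values m h x n ! (i - 1)) /
     (real (trim_index m n \<beta>) - real (trim_index m n \<alpha>))"

definition trim_kernel :: "(real \<Rightarrow> real) \<Rightarrow> real \<Rightarrow> real \<Rightarrow> real \<Rightarrow> real" where
  "trim_kernel H \<alpha> \<beta> y =
     ((y - xi_minus H \<beta>) * indicat_real {..xi_minus H \<beta>} y + \<beta> * xi_minus H \<beta>) -
     ((y - xi_plus H \<alpha>) * indicat_real {..<xi_plus H \<alpha>} y + \<alpha> * xi_plus H \<alpha>)"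

definition theta :: "(real \<Rightarrow> real) \<Rightarrow> real \<Rightarrow> real \<Rightarrow> real" where
  "theta H \<alpha> \<beta> = (\<integral>y. trim_kernel H \<alpha> \<beta> y \<partial>interval_measure H)"

text \<open>
  Here \<open>h(x, \<cdot>)\<close> is \<open>h(x, X\<^sub>2, \<dots>, X\<^sub>m)\<close>. The two expectations defining \<open>g\<close> may both be
  infinite when \<open>h\<close> has no first moment, although the difference of their integrands is
  bounded. So, as in \<open>\<theta>\<close>, the difference is taken under a single expectation; the lemma
  \<open>proj_g_eq\<close> recovers the two separate expectations whenever they are finite.
\<close>

definition kernel_section :: "(nat \<Rightarrow> 'b \<Rightarrow> 'a) \<Rightarrow> nat \<Rightarrow> ((nat \<Rightarrow> 'a) \<Rightarrow> real) \<Rightarrow> 'a \<Rightarrow> 'b \<Rightarrow> real" where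
  "kernel_section X m h x \<omega> = h (\<lambda>j\<in>{1..m}. if j = 1 then x else X j \<omega>)"

definition proj_g :: "'b measure \<Rightarrow> (nat \<Rightarrow> 'b \<Rightarrow> 'a) \<Rightarrow> nat \<Rightarrow> ((nat \<Rightarrow> 'a) \<Rightarrow> real) \<Rightarrow>
    real \<Rightarrow> real \<Rightarrow> 'a \<Rightarrow> real" where
  "proj_g M X m h \<alpha> \<beta> x =
     (let H = kernel_cdf M X m h
      in (\<integral>\<omega>. trim_kernel H \<alpha> \<beta> (kernel_section X m h x \<omega>) \<partial>M) - theta H \<alpha> \<beta>)"

lemma proj_g_eq:
  fixes M :: "'b measure" and X :: "nat \<Rightarrow> 'b \<Rightarrow> 'a" and m :: nat and h :: "(nat \<Rightarrow> 'a) \<Rightarrow> real"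
  defines "H \<equiv> kernel_cdf M X m h"
  assumes "prob_space M"
    and b: "integrable M (\<lambda>\<omega>. indicat_real {..xi_minus H \<beta>} (kernel_section X m h x \<omega>) *
                           (kernel_section X m h x \<omega> - xi_minus H \<beta>))" (is "integrable M ?B")
    and a: "integrable M (\<lambda>\<omega>. indicat_real {..<xi_plus H \<alpha>} (kernel_section X m h x \<omega>) *
                           (kernel_section X m h x \<omega> - xi_plus H \<alpha>))" (is "integrable M ?A")
  shows "proj_g M X m h \<alpha> \<beta> x =
           ((\<integral>\<omega>. ?B \<omega> \<partial>M) + \<beta> * xi_minus H \<beta>) - ((\<integral>\<omega>. ?A \<omega> \<partial>M) + \<alpha> * xi_plus H \<alpha>) - theta H \<alpha> \<beta>"
proof -
  interpret prob_space M by fact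
  have "(\<integral>\<omega>. trim_kernel H \<alpha> \<beta> (kernel_section X m h x \<omega>) \<partial>M) =
        (\<integral>\<omega>. (?B \<omega> + \<beta> * xi_minus H \<beta>) - (?A \<omega> + \<alpha> * xi_plus H \<alpha>) \<partial>M)"
    by (simp add: trim_kernel_def mult.commute)
  also have "\<dots> = ((\<integral>\<omega>. ?B \<omega> \<partial>M) + \<beta> * xi_minus H \<beta>) - ((\<integral>\<omega>. ?A \<omega> \<partial>M) + \<alpha> * xi_plus H \<alpha>)"
    using a b by (simp add: prob_space)
  finally show ?thesis
    by (simp add: proj_g_def H_def Let_def)
qed

text \<open>\<open>X 0\<close> is the generic copy \<open>X\<close>; the sample is \<open>X 1, X 2, \<dots>\<close>\<close>

definition sigma2_g :: "'b measure \<Rightarrow> (nat \<Rightarrow> 'b \<Rightarrow> 'a) \<Rightarrow> nat \<Rightarrow> ((nat \<Rightarrow> 'a) \<Rightarrow> real) \<Rightarrow>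
    real \<Rightarrow> real \<Rightarrow> real" where
  "sigma2_g M X m h \<alpha> \<beta> = (\<integral>\<omega>. (proj_g M X m h \<alpha> \<beta> (X 0 \<omega>))\<^sup>2 \<partial>M)"

end

theory Submission
  imports Defs
begin

text \<open>
  Write \<open>N\<close> for \<open>n choose m\<close>, \<open>a\<close> and \<open>b\<close> for the quantiles of \<open>H\<close> at \<open>\<alpha>\<close> and \<open>\<beta>\<close>, and \<open>T\<close> for
  \<^const>\<open>trim_kernel\<close>. Since \<open>T y = (min (y - b) 0 + \<beta> b) - (min (y - a) 0 + \<alpha> a)\<close>, the kernel \<open>T \<circ> h\<close> is
  bounded and symmetric. Its mean is \<open>\<theta>\<close> and its centred first projection is \<open>g\<close>, whatever the
  moments of \<open>h\<close> are. The trimmed U-statistic turns out to differ from the ordinary U-statistic of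
  \<open>T \<circ> h\<close> by \<open>o\<^sub>P(n\<^sup>-\<^sup>1\<^sup>/\<^sup>2)\<close>, so it inherits the central limit theorem of the latter.

  The U-statistic of a bounded kernel is \<open>\<theta> + (m / n) \<Sum> g(X\<^sub>i)\<close> up to a remainder that averages
  the residuals \<open>k(X\<^sub>I) - \<theta> - (\<Sum>i\<in>I. g(X\<^sub>i))\<close> over all index sets \<open>I\<close>. Residuals of index sets with at
  most one common index are orthogonal (\<open>residuals_orthogonal\<close>), and only a fraction \<open>O(n\<^sup>-\<^sup>2)\<close> of all pairs
  of index sets has two common indices. Hence the remainder is \<open>O(1 / n)\<close> in \<open>L\<^sup>2\<close>
  (\<open>hajek_remainder_second_moment_le\<close>), and the classical central limit theorem for \<open>g(X\<^sub>i)\<close> decides.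
  The same count with one common index bounds the variance of every bounded U-statistic by a multiple of \<open>1 / n\<close>.

  The comparison with \<open>T \<circ> h\<close> treats the two trimming levels separately. For a level \<open>\<gamma>\<close> with quantile
  \<open>q\<close>, the sum of the \<open>k = [\<gamma> N]\<close> smallest values is \<open>k q + \<Sum> min (h\<^sub>I - q) 0\<close> up to
  \<open>\<bar>h\<^sub>(\<^sub>k\<^sub>) - q\<bar>\<close> times the number of values by which \<open>k\<close> exceeds the count of \<open>h\<^sub>I \<le> q\<close> or
  falls short of the count of \<open>h\<^sub>I < q\<close> (\<open>partial_sum_sorted_approx\<close>). Because
  \<open>P(h < q) \<le> \<gamma> \<le> P(h \<le> q)\<close>, that number is, up to rounding, at most the deviation of an empirical count from its
  mean, thus of order \<open>N / \<surd>n\<close>, also when \<open>H\<close> jumps at \<open>q\<close>. Continuity of the quantile function at \<open>\<gamma>\<close>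
  makes \<open>q\<close> the only \<open>\<gamma>\<close>-quantile, so \<open>h\<^sub>(\<^sub>k\<^sub>) \<rightarrow> q\<close> in probability. The product of the two factors, divided by \<open>N\<close>, is
  therefore \<open>o\<^sub>P(n\<^sup>-\<^sup>1\<^sup>/\<^sup>2)\<close> (\<open>linearization_error_negligible\<close>). Rounding \<open>\<gamma> N\<close> to an integer costs
  \<open>O(1 / N)\<close>, and \<open>\<surd>n / N \<rightarrow> 0\<close>. Slutsky's lemma puts the parts together.
\<close>

section \<open>Partial sums of sorted lists\<close>

lemma nth_iff_less_length_filter:
  fixes xs :: "'a::linorder list"
  assumes "sorted xs" "i < length xs" and down: "\<And>x y. x \<le> y \<Longrightarrow> P y \<Longrightarrow> P x"
  shows "P (xs ! i) \<longleftrightarrow> i < length (filter P xs)"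
  using assms(1,2)
proof (induction xs arbitrary: i)
  case (Cons a xs)
  show ?case
  proof (cases "P a")
    case True
    then show ?thesis using Cons by (cases i) auto
  next
    case False
    then have *: "\<forall>x\<in>set (a # xs). \<not> P x" using Cons.prems down by auto
    then have "filter P (a # xs) = []" by (simp only: filter_empty_conv)
    moreover have "\<not> P ((a # xs) ! i)" using * Cons.prems nth_mem by blast
    ultimately show ?thesis by simp
  qed
qed simp

text \<open>
  After subtracting \<open>q\<close> from every entry, the left-hand side is what \<open>\<Sum>i<k. xs ! i\<close> contains in excess of the
  negative entries (the positive entries before position \<open>k\<close>) plus what it misses (the negative entries
  from position \<open>k\<close> on). By sortedness, these entries occupy the positions between \<open>K\<close> and \<open>k\<close>, respectively between
  \<open>k\<close> and \<open>K'\<close>, and none of them is further from \<open>q\<close> than the entry at position \<open>k - 1\<close>. The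
  truncated differences are intended: at most one of them is positive.
\<close>

lemma partial_sum_sorted_approx:
  fixes xs :: "real list" and q :: real
  assumes "sorted xs" "1 \<le> k" "k \<le> length xs"
  defines "K \<equiv> length (filter (\<lambda>x. x \<le> q) xs)" and "K' \<equiv> length (filter (\<lambda>x. x < q) xs)"
  shows "\<bar>(\<Sum>i<k. xs ! i) - real k * q - (\<Sum>x\<leftarrow>xs. min (x - q) 0)\<bar>
           \<le> \<bar>xs ! (k - 1) - q\<bar> * (real (k - K) + real (K' - k))"
proof -
  let ?n = "length xs" and ?d = "\<bar>xs ! (k - 1) - q\<bar>"
  have "(\<Sum>x\<leftarrow>xs. min (x - q) 0) = (\<Sum>i<?n. min (xs ! i - q) 0)"
    by (simp add: sum_list_sum_nth atLeast0LessThan)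
  also have "\<dots> = (\<Sum>i<k. min (xs ! i - q) 0) + (\<Sum>i=k..<?n. min (xs ! i - q) 0)"
    using assms(3) by (metis atLeast0LessThan le0 sum.atLeastLessThan_concat)
  finally have split: "(\<Sum>i<k. xs ! i) - real k * q - (\<Sum>x\<leftarrow>xs. min (x - q) 0) =
      (\<Sum>i<k. max (xs ! i - q) 0) + (\<Sum>i=k..<?n. max (q - xs ! i) 0)"
  proof -
    assume *: "(\<Sum>x\<leftarrow>xs. min (x - q) 0) = (\<Sum>i<k. min (xs ! i - q) 0) + (\<Sum>i=k..<?n. min (xs ! i - q) 0)"
    have "(\<Sum>i<k. max (xs ! i - q) 0) = (\<Sum>i<k. xs ! i - q - min (xs ! i - q) 0)"
      by (intro sum.cong) auto
    moreover have "(\<Sum>i=k..<?n. max (q - xs ! i) 0) = (\<Sum>i=k..<?n. - min (xs ! i - q) 0)"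
      by (intro sum.cong) auto
    ultimately show ?thesis
      using * by (simp add: sum_subtractf sum_negf)
  qed
  have upper: "(\<Sum>i<k. max (xs ! i - q) 0) \<le> ?d * real (k - K)"
  proof -
    have "(\<Sum>i<k. max (xs ! i - q) 0) = (\<Sum>i\<in>{K..<k}. max (xs ! i - q) 0)"
    proof (rule sum.mono_neutral_right)
      show "\<forall>i\<in>{..<k} - {K..<k}. max (xs ! i - q) 0 = 0"
      proof
        fix i assume "i \<in> {..<k} - {K..<k}"
        then have "i < ?n" "i < K" using assms(3) by auto
        then have "xs ! i \<le> q" using nth_iff_less_length_filter[OF assms(1), of i "\<lambda>x. x \<le> q"] by (simp add: K_def)
        then show "max (xs ! i - q) 0 = 0" by simp
      qed
    qed auto
    also have "\<dots> \<le> (\<Sum>i\<in>{K..<k}. ?d)"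
    proof (rule sum_mono)
      fix i assume "i \<in> {K..<k}"
      then have "xs ! i \<le> xs ! (k - 1)"
        using assms(1,3) by (intro sorted_nth_mono) auto
      then show "max (xs ! i - q) 0 \<le> ?d" by auto
    qed
    finally show ?thesis by (simp add: mult.commute)
  qed
  have lower: "(\<Sum>i=k..<?n. max (q - xs ! i) 0) \<le> ?d * real (K' - k)"
  proof -
    have "K' \<le> ?n" by (simp add: K'_def)
    then have "(\<Sum>i=k..<?n. max (q - xs ! i) 0) = (\<Sum>i\<in>{k..<K'}. max (q - xs ! i) 0)"
    proof (intro sum.mono_neutral_right)
      show "\<forall>i\<in>{k..<?n} - {k..<K'}. max (q - xs ! i) 0 = 0"
      proof
        fix i assume "i \<in> {k..<?n} - {k..<K'}"
        then have "i < ?n" "\<not> i < K'" by auto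
        then have "\<not> xs ! i < q" using nth_iff_less_length_filter[OF assms(1), of i "\<lambda>x. x < q"] by (simp add: K'_def)
        then show "max (q - xs ! i) 0 = 0" by simp
      qed
    qed auto
    also have "\<dots> \<le> (\<Sum>i\<in>{k..<K'}. ?d)"
    proof (rule sum_mono)
      fix i assume "i \<in> {k..<K'}"
      then have "xs ! (k - 1) \<le> xs ! i"
        using assms(1,3) \<open>K' \<le> ?n\<close> by (intro sorted_nth_mono) auto
      then show "max (q - xs ! i) 0 \<le> ?d" by auto
    qed
    finally show ?thesis by (simp add: mult.commute)
  qed
  have "0 \<le> (\<Sum>i<k. max (xs ! i - q) 0) + (\<Sum>i=k..<?n. max (q - xs ! i) 0)"
    by (intro add_nonneg_nonneg sum_nonneg) auto
  then show ?thesis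
    using upper lower by (simp add: split distrib_left)
qed

section \<open>Convergence to zero in probability\<close>

context prob_space begin

definition tends_to_zero_in_prob :: "(nat \<Rightarrow> 'a \<Rightarrow> real) \<Rightarrow> bool" where
  "tends_to_zero_in_prob Z \<longleftrightarrow> (\<forall>\<epsilon>>0. (\<lambda>n. prob {\<omega> \<in> space M. \<epsilon> < \<bar>Z n \<omega>\<bar>}) \<longlonglongrightarrow> 0)"

lemma tends_to_zero_in_prob_dominated:
  assumes "tends_to_zero_in_prob W" and [measurable]: "\<And>n. W n \<in> borel_measurable M"
    and "\<forall>\<^sub>F n in sequentially. \<forall>\<omega>\<in>space M. \<bar>Z n \<omega>\<bar> \<le> \<bar>W n \<omega>\<bar>"
  shows "tends_to_zero_in_prob Z"
  unfolding tends_to_zero_in_prob_def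
proof (intro allI impI)
  fix \<epsilon> :: real assume "0 < \<epsilon>"
  then have lim: "(\<lambda>n. prob {\<omega> \<in> space M. \<epsilon> < \<bar>W n \<omega>\<bar>}) \<longlonglongrightarrow> 0"
    using assms(1) by (simp add: tends_to_zero_in_prob_def)
  show "(\<lambda>n. prob {\<omega> \<in> space M. \<epsilon> < \<bar>Z n \<omega>\<bar>}) \<longlonglongrightarrow> 0"
  proof (rule Lim_null_comparison[OF _ lim])
    show "\<forall>\<^sub>F n in sequentially. norm (prob {\<omega> \<in> space M. \<epsilon> < \<bar>Z n \<omega>\<bar>}) \<le> prob {\<omega> \<in> space M. \<epsilon> < \<bar>W n \<omega>\<bar>}"
      using assms(3)
    proof eventually_elim
      case (elim n)
      have "prob {\<omega> \<in> space M. \<epsilon> < \<bar>Z n \<omega>\<bar>} \<le> prob {\<omega> \<in> space M. \<epsilon> < \<bar>W n \<omega>\<bar>}"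
        using elim by (intro finite_measure_mono) fastforce+
      then show ?case by simp
    qed
  qed
qed

lemma tends_to_zero_in_prob_add:
  assumes "tends_to_zero_in_prob Z" "tends_to_zero_in_prob W"
    and [measurable]: "\<And>n. Z n \<in> borel_measurable M" "\<And>n. W n \<in> borel_measurable M"
  shows "tends_to_zero_in_prob (\<lambda>n \<omega>. Z n \<omega> + W n \<omega>)"
  unfolding tends_to_zero_in_prob_def
proof (intro allI impI)
  fix \<epsilon> :: real assume "0 < \<epsilon>"
  then have lim: "(\<lambda>n. prob {\<omega> \<in> space M. \<epsilon> / 2 < \<bar>Z n \<omega>\<bar>} + prob {\<omega> \<in> space M. \<epsilon> / 2 < \<bar>W n \<omega>\<bar>}) \<longlonglongrightarrow> 0 + 0"
    using assms(1,2) unfolding tends_to_zero_in_prob_def by (intro tendsto_add) (meson half_gt_zero)+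
  have "prob {\<omega> \<in> space M. \<epsilon> < \<bar>Z n \<omega> + W n \<omega>\<bar>}
      \<le> prob {\<omega> \<in> space M. \<epsilon> / 2 < \<bar>Z n \<omega>\<bar>} + prob {\<omega> \<in> space M. \<epsilon> / 2 < \<bar>W n \<omega>\<bar>}" for n
  proof -
    have "prob {\<omega> \<in> space M. \<epsilon> < \<bar>Z n \<omega> + W n \<omega>\<bar>}
      \<le> prob ({\<omega> \<in> space M. \<epsilon> / 2 < \<bar>Z n \<omega>\<bar>} \<union> {\<omega> \<in> space M. \<epsilon> / 2 < \<bar>W n \<omega>\<bar>})"
      by (rule finite_measure_mono) auto
    also have "\<dots> \<le> prob {\<omega> \<in> space M. \<epsilon> / 2 < \<bar>Z n \<omega>\<bar>} + prob {\<omega> \<in> space M. \<epsilon> / 2 < \<bar>W n \<omega>\<bar>}"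
      by (rule measure_Un_le) auto
    finally show ?thesis .
  qed
  then show "(\<lambda>n. prob {\<omega> \<in> space M. \<epsilon> < \<bar>Z n \<omega> + W n \<omega>\<bar>}) \<longlonglongrightarrow> 0"
    using lim by (intro Lim_null_comparison[OF _ lim[simplified]]) auto
qed

lemma prob_abs_greater_le_second_moment:
  assumes [measurable]: "W \<in> borel_measurable M"
    and "integrable M (\<lambda>\<omega>. (W \<omega>)\<^sup>2)" "0 < K"
  shows "prob {\<omega> \<in> space M. K < \<bar>W \<omega>\<bar>} \<le> (\<integral>\<omega>. (W \<omega>)\<^sup>2 \<partial>M) / K\<^sup>2"
proof -
  have "prob {\<omega> \<in> space M. K < \<bar>W \<omega>\<bar>} \<le> prob {\<omega> \<in> space M. K\<^sup>2 \<le> (W \<omega>)\<^sup>2}"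
  proof (intro finite_measure_mono)
    show "{\<omega> \<in> space M. K < \<bar>W \<omega>\<bar>} \<subseteq> {\<omega> \<in> space M. K\<^sup>2 \<le> (W \<omega>)\<^sup>2}"
    proof clarify
      fix \<omega> assume "K < \<bar>W \<omega>\<bar>"
      then show "K\<^sup>2 \<le> (W \<omega>)\<^sup>2" using assms(3) power_mono[of K "\<bar>W \<omega>\<bar>" 2] by simp
    qed
  qed measurable
  also have "\<dots> \<le> (\<integral>\<omega>. (W \<omega>)\<^sup>2 \<partial>M) / K\<^sup>2"
    using assms by (intro integral_Markov_inequality_measure[where A="{}"]) auto
  finally show ?thesis .
qed

lemma tends_to_zero_in_prob_if_second_moment:
  assumes [measurable]: "\<And>n. Z n \<in> borel_measurable M"
    and int: "\<And>n. integrable M (\<lambda>\<omega>. (Z n \<omega>)\<^sup>2)"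
    and lim: "(\<lambda>n. \<integral>\<omega>. (Z n \<omega>)\<^sup>2 \<partial>M) \<longlonglongrightarrow> 0"
  shows "tends_to_zero_in_prob Z"
  unfolding tends_to_zero_in_prob_def
proof (intro allI impI)
  fix \<epsilon> :: real assume "0 < \<epsilon>"
  have "(\<lambda>n. (\<integral>\<omega>. (Z n \<omega>)\<^sup>2 \<partial>M) / \<epsilon>\<^sup>2) \<longlonglongrightarrow> 0 / \<epsilon>\<^sup>2"
    using \<open>0 < \<epsilon>\<close> by (intro tendsto_divide lim) auto
  then have lim': "(\<lambda>n. (\<integral>\<omega>. (Z n \<omega>)\<^sup>2 \<partial>M) / \<epsilon>\<^sup>2) \<longlonglongrightarrow> 0" by simp
  have "norm (prob {\<omega> \<in> space M. \<epsilon> < \<bar>Z n \<omega>\<bar>}) \<le> (\<integral>\<omega>. (Z n \<omega>)\<^sup>2 \<partial>M) / \<epsilon>\<^sup>2" for n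
    using prob_abs_greater_le_second_moment[OF _ int \<open>0 < \<epsilon>\<close>, of n] by simp
  then show "(\<lambda>n. prob {\<omega> \<in> space M. \<epsilon> < \<bar>Z n \<omega>\<bar>}) \<longlonglongrightarrow> 0"
    by (intro Lim_null_comparison[OF always_eventually lim'] allI)
qed

lemma tends_to_zero_in_prob_const:
  assumes "c \<longlonglongrightarrow> 0"
  shows "tends_to_zero_in_prob (\<lambda>n _. c n)"
  unfolding tends_to_zero_in_prob_def
proof (intro allI impI)
  fix \<epsilon> :: real assume "0 < \<epsilon>"
  then have "\<forall>\<^sub>F n in sequentially. \<bar>c n\<bar> < \<epsilon>"
    using assms by (auto simp: tendsto_iff dist_real_def)
  then have "\<forall>\<^sub>F n in sequentially. prob {\<omega> \<in> space M. \<epsilon> < \<bar>c n\<bar>} = 0"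
    by eventually_elim auto
  then show "(\<lambda>n. prob {\<omega> \<in> space M. \<epsilon> < \<bar>c n\<bar>}) \<longlonglongrightarrow> 0"
    by (rule tendsto_eventually)
qed

text \<open>
  By Chebyshev's inequality, \<open>\<bar>W n\<bar> \<le> K\<close> outside an event of probability \<open>C / K\<^sup>2\<close>, uniformly in \<open>n\<close>; on
  the rest, \<open>\<bar>Z n * W n\<bar> > \<epsilon>\<close> forces \<open>\<bar>Z n\<bar> > \<epsilon> / K\<close>.
\<close>

lemma tends_to_zero_in_prob_mult_bounded:
  assumes Z: "tends_to_zero_in_prob Z"
    and [measurable]: "\<And>n. Z n \<in> borel_measurable M" "\<And>n. W n \<in> borel_measurable M"
    and int: "\<And>n. integrable M (\<lambda>\<omega>. (W n \<omega>)\<^sup>2)"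
    and C: "\<forall>\<^sub>F n in sequentially. (\<integral>\<omega>. (W n \<omega>)\<^sup>2 \<partial>M) \<le> C"
  shows "tends_to_zero_in_prob (\<lambda>n \<omega>. Z n \<omega> * W n \<omega>)"
  unfolding tends_to_zero_in_prob_def
proof (intro allI impI)
  fix \<epsilon> :: real assume eps: "0 < \<epsilon>"
  have "\<exists>n. (\<integral>\<omega>. (W n \<omega>)\<^sup>2 \<partial>M) \<le> C" using C eventually_happens by force
  moreover have "0 \<le> (\<integral>\<omega>. (W n \<omega>)\<^sup>2 \<partial>M)" for n by simp
  ultimately have C0: "0 \<le> C" by (meson order_trans)
  show "(\<lambda>n. prob {\<omega> \<in> space M. \<epsilon> < \<bar>Z n \<omega> * W n \<omega>\<bar>}) \<longlonglongrightarrow> 0"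
  proof (rule LIMSEQ_I)
    fix \<delta> :: real assume "0 < \<delta>"
    \<comment> \<open>chosen so that \<open>C / K\<^sup>2\<close> stays below \<open>\<delta> / 2\<close>, also for \<open>C = 0\<close>\<close>
    define K where "K = sqrt (2 * (C + 1) / \<delta>)"
    have K: "0 < K" "C / K\<^sup>2 < \<delta> / 2 + 0"
      using C0 \<open>0 < \<delta>\<close> by (simp_all add: K_def field_simps)
    have "(\<lambda>n. prob {\<omega> \<in> space M. \<epsilon> / K < \<bar>Z n \<omega>\<bar>}) \<longlonglongrightarrow> 0"
      using Z eps K by (simp add: tends_to_zero_in_prob_def)
    then have "\<forall>\<^sub>F n in sequentially. prob {\<omega> \<in> space M. \<epsilon> / K < \<bar>Z n \<omega>\<bar>} < \<delta> / 2"
      using \<open>0 < \<delta>\<close> by (intro order_tendstoD(2)) auto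
    with C have "\<forall>\<^sub>F n in sequentially. prob {\<omega> \<in> space M. \<epsilon> < \<bar>Z n \<omega> * W n \<omega>\<bar>} < \<delta>"
    proof eventually_elim
      case (elim n)
      have "prob {\<omega> \<in> space M. \<epsilon> < \<bar>Z n \<omega> * W n \<omega>\<bar>}
        \<le> prob ({\<omega> \<in> space M. \<epsilon> / K < \<bar>Z n \<omega>\<bar>} \<union> {\<omega> \<in> space M. K < \<bar>W n \<omega>\<bar>})"
      proof (intro finite_measure_mono)
        show "{\<omega> \<in> space M. \<epsilon> < \<bar>Z n \<omega> * W n \<omega>\<bar>} \<subseteq>
          {\<omega> \<in> space M. \<epsilon> / K < \<bar>Z n \<omega>\<bar>} \<union> {\<omega> \<in> space M. K < \<bar>W n \<omega>\<bar>}"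
        proof (rule subsetI, rule ccontr)
          fix \<omega> assume *: "\<omega> \<in> {\<omega> \<in> space M. \<epsilon> < \<bar>Z n \<omega> * W n \<omega>\<bar>}"
            "\<omega> \<notin> {\<omega> \<in> space M. \<epsilon> / K < \<bar>Z n \<omega>\<bar>} \<union> {\<omega> \<in> space M. K < \<bar>W n \<omega>\<bar>}"
          then have "\<bar>Z n \<omega>\<bar> * \<bar>W n \<omega>\<bar> \<le> \<epsilon> / K * K"
            using K eps by (intro mult_mono) auto
          then show False using * K by (simp add: abs_mult)
        qed
      qed measurable
      also have "\<dots> \<le> prob {\<omega> \<in> space M. \<epsilon> / K < \<bar>Z n \<omega>\<bar>} + prob {\<omega> \<in> space M. K < \<bar>W n \<omega>\<bar>}"
        by (rule measure_Un_le) auto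
      also have "prob {\<omega> \<in> space M. K < \<bar>W n \<omega>\<bar>} \<le> (\<integral>\<omega>. (W n \<omega>)\<^sup>2 \<partial>M) / K\<^sup>2"
        by (rule prob_abs_greater_le_second_moment[OF _ int K(1)]) simp
      also have "\<dots> \<le> C / K\<^sup>2" using elim K by (intro divide_right_mono) auto
      finally show ?case using K elim by linarith
    qed
    then show "\<exists>no. \<forall>n\<ge>no. norm (prob {\<omega> \<in> space M. \<epsilon> < \<bar>Z n \<omega> * W n \<omega>\<bar>} - 0) < \<delta>"
      by (simp add: eventually_sequentially)
  qed
qed

section \<open>Slutsky's lemma via characteristic functions\<close>

text \<open>
  The integrand \<open>e\<^sup>i\<^sup>t\<^sup>Y (e\<^sup>i\<^sup>t\<^sup>Z - 1)\<close> has modulus at most \<open>\<bar>t Z\<bar>\<close> and at most 2; the first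
  bound serves where \<open>\<bar>Z\<bar> \<le> \<epsilon>\<close>, the second one elsewhere.
\<close>

lemma char_distr_perturb:
  assumes [measurable]: "Y \<in> borel_measurable M" "Z \<in> borel_measurable M" and "0 \<le> \<epsilon>"
  shows "norm (char (distr M borel (\<lambda>\<omega>. Y \<omega> + Z \<omega>)) t - char (distr M borel Y) t)
           \<le> \<bar>t\<bar> * \<epsilon> + 2 * prob {\<omega> \<in> space M. \<epsilon> < \<bar>Z \<omega>\<bar>}"
proof -
  let ?A = "{\<omega> \<in> space M. \<epsilon> < \<bar>Z \<omega>\<bar>}"
  have int: "integrable M (\<lambda>\<omega>. iexp (t * (Y \<omega> + Z \<omega>)))" "integrable M (\<lambda>\<omega>. iexp (t * Y \<omega>))"
    by (rule integrable_const_bound[of _ 1]; auto)+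
  have "char (distr M borel (\<lambda>\<omega>. Y \<omega> + Z \<omega>)) t - char (distr M borel Y) t
     = (\<integral>\<omega>. iexp (t * (Y \<omega> + Z \<omega>)) - iexp (t * Y \<omega>) \<partial>M)"
    using int by (simp add: char_def integral_distr)
  also have "norm \<dots> \<le> (\<integral>\<omega>. norm (iexp (t * (Y \<omega> + Z \<omega>)) - iexp (t * Y \<omega>)) \<partial>M)"
    by (rule integral_norm_bound)
  also have "\<dots> \<le> (\<integral>\<omega>. \<bar>t\<bar> * \<epsilon> + 2 * indicat_real ?A \<omega> \<partial>M)"
  proof (rule integral_mono)
    show "integrable M (\<lambda>\<omega>. norm (iexp (t * (Y \<omega> + Z \<omega>)) - iexp (t * Y \<omega>)))"
      using int by (intro integrable_norm Bochner_Integration.integrable_diff)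
    show "integrable M (\<lambda>\<omega>. \<bar>t\<bar> * \<epsilon> + 2 * indicat_real ?A \<omega>)"
      by (intro Bochner_Integration.integrable_add integrable_const integrable_mult_right
          integrable_real_indicator) (auto simp: emeasure_eq_measure)
  next
    fix \<omega> assume "\<omega> \<in> space M"
    have "iexp (t * (Y \<omega> + Z \<omega>)) - iexp (t * Y \<omega>) = iexp (t * Y \<omega>) * (iexp (t * Z \<omega>) - 1)"
      by (simp add: exp_add[symmetric] algebra_simps)
    then have eq: "norm (iexp (t * (Y \<omega> + Z \<omega>)) - iexp (t * Y \<omega>)) = norm (iexp (t * Z \<omega>) - 1)"
      by (simp add: norm_mult)
    show "norm (iexp (t * (Y \<omega> + Z \<omega>)) - iexp (t * Y \<omega>)) \<le> \<bar>t\<bar> * \<epsilon> + 2 * indicat_real ?A \<omega>"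
    proof (cases "\<omega> \<in> ?A")
      case True
      have "norm (iexp (t * Z \<omega>) - 1) \<le> norm (iexp (t * Z \<omega>)) + norm (1::complex)"
        by (rule norm_triangle_ineq4)
      also have "\<dots> = 2" by simp
      finally show ?thesis using True eq \<open>0 \<le> \<epsilon>\<close> by (simp add: add_increasing)
    next
      case False
      then have "\<bar>Z \<omega>\<bar> \<le> \<epsilon>" using \<open>\<omega> \<in> space M\<close> by auto
      moreover have "norm (iexp (t * Z \<omega>) - 1) \<le> \<bar>t * Z \<omega>\<bar>"
        using iexp_approx1[of "t * Z \<omega>" 0] by simp
      ultimately have "norm (iexp (t * Z \<omega>) - 1) \<le> \<bar>t\<bar> * \<epsilon>"
        by (metis abs_ge_zero abs_mult mult_left_mono order_trans)
      then show ?thesis using False eq by simp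
    qed
  qed
  also have "\<dots> = \<bar>t\<bar> * \<epsilon> + 2 * prob ?A"
    by (subst Bochner_Integration.integral_add) (auto simp: emeasure_eq_measure prob_space)
  finally show ?thesis .
qed

text \<open>
  The limit of \<open>Y\<close> is assumed in terms of characteristic functions, because the perturbation estimate and
  Levy's continuity theorem then give the claim directly.
\<close>

lemma slutsky_add:
  assumes [measurable]: "\<And>n. Y n \<in> borel_measurable M" "\<And>n. Z n \<in> borel_measurable M"
    and L: "real_distribution L"
    and Y: "\<And>t. (\<lambda>n. char (distr M borel (Y n)) t) \<longlonglongrightarrow> char L t"
    and Z: "tends_to_zero_in_prob Z"
  shows "weak_conv_m (\<lambda>n. distr M borel (\<lambda>\<omega>. Y n \<omega> + Z n \<omega>)) L"
proof (rule levy_continuity[OF _ L])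
  show "real_distribution (distr M borel (\<lambda>\<omega>. Y n \<omega> + Z n \<omega>))" for n
    by (rule real_distribution_distr) simp
  fix t
  have "(\<lambda>n. char (distr M borel (\<lambda>\<omega>. Y n \<omega> + Z n \<omega>)) t - char (distr M borel (Y n)) t) \<longlonglongrightarrow> 0"
  proof (rule LIMSEQ_I)
    fix \<delta> :: real assume "0 < \<delta>"
    define \<epsilon> where "\<epsilon> = \<delta> / (2 * (\<bar>t\<bar> + 1))"
    have eps: "0 < \<epsilon>" "\<bar>t\<bar> * \<epsilon> \<le> \<delta> / 2"
      using \<open>0 < \<delta>\<close> by (simp_all add: \<epsilon>_def field_simps)
    have "(\<lambda>n. prob {\<omega> \<in> space M. \<epsilon> < \<bar>Z n \<omega>\<bar>}) \<longlonglongrightarrow> 0"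
      using Z eps by (simp add: tends_to_zero_in_prob_def)
    then have "\<forall>\<^sub>F n in sequentially. prob {\<omega> \<in> space M. \<epsilon> < \<bar>Z n \<omega>\<bar>} < \<delta> / 4"
      using \<open>0 < \<delta>\<close> by (intro order_tendstoD(2)) auto
    then have "\<forall>\<^sub>F n in sequentially.
        norm (char (distr M borel (\<lambda>\<omega>. Y n \<omega> + Z n \<omega>)) t - char (distr M borel (Y n)) t) < \<delta>"
    proof eventually_elim
      case (elim n)
      have "norm (char (distr M borel (\<lambda>\<omega>. Y n \<omega> + Z n \<omega>)) t - char (distr M borel (Y n)) t)
        \<le> \<bar>t\<bar> * \<epsilon> + 2 * prob {\<omega> \<in> space M. \<epsilon> < \<bar>Z n \<omega>\<bar>}"
        using eps by (intro char_distr_perturb) auto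
      then show ?case using elim eps by linarith
    qed
    then show "\<exists>no. \<forall>n\<ge>no. norm (char (distr M borel (\<lambda>\<omega>. Y n \<omega> + Z n \<omega>)) t
        - char (distr M borel (Y n)) t - 0) < \<delta>"
      by (simp add: eventually_sequentially)
  qed
  from tendsto_add[OF this Y[of t]]
  show "(\<lambda>n. char (distr M borel (\<lambda>\<omega>. Y n \<omega> + Z n \<omega>)) t) \<longlonglongrightarrow> char L t" by simp
qed

end

section \<open>Conditioning in an i.i.d. sample\<close>

locale iid_sample = prob_space M for M :: "'b measure" +
  fixes S F :: "'a measure" and X :: "nat \<Rightarrow> 'b \<Rightarrow> 'a"
  assumes indep: "indep_vars (\<lambda>_. S) X UNIV"
    and distr_X: "\<And>i. distr M S (X i) = F"
begin

lemma X_measurable [measurable]: "X i \<in> measurable M S"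
  using indep by (auto simp: indep_vars_def2)

lemma X_in_space: "\<omega> \<in> space M \<Longrightarrow> X i \<omega> \<in> space S"
  using X_measurable by (rule measurable_space)

lemma sets_F: "sets F = sets S"
  using distr_X[of 0] by auto

lemma prob_space_F: "prob_space F"
  using prob_space_distr[OF X_measurable[of 0]] by (simp add: distr_X)

lemma restrict_X_measurable: "(\<lambda>\<omega>. \<lambda>j\<in>J. X (t j) \<omega>) \<in> measurable M (\<Pi>\<^sub>M j\<in>J. S)"
  by (intro measurable_restrict) simp

text \<open>
  Every injective selection from an i.i.d. sample is again i.i.d., so expectations of functions of several
  observations do not depend on which distinct observations are inserted.
\<close>

lemma distr_reindexed_sample:
  assumes "inj_on t J"
  shows "distr M (\<Pi>\<^sub>M j\<in>J. S) (\<lambda>\<omega>. \<lambda>j\<in>J. X (t j) \<omega>) = (\<Pi>\<^sub>M j\<in>J. F)"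
proof -
  have sets: "sets (\<Pi>\<^sub>M i\<in>I. F) = sets (\<Pi>\<^sub>M i\<in>I. S)" for I :: "'c set"
    by (rule sets_PiM_cong) (simp_all add: sets_F)
  have joint: "distr M (\<Pi>\<^sub>M i\<in>UNIV. S) (\<lambda>\<omega>. \<lambda>i\<in>UNIV. X i \<omega>) = (\<Pi>\<^sub>M i\<in>UNIV. F)"
    using indep by (subst (asm) indep_vars_iff_distr_eq_PiM) (simp_all add: distr_X)
  have "(\<Pi>\<^sub>M j\<in>J. F) = distr (\<Pi>\<^sub>M i\<in>UNIV. F) (\<Pi>\<^sub>M j\<in>J. F) (\<lambda>\<omega>. \<lambda>n\<in>J. \<omega> (t n))"
    using distr_PiM_reindex[of UNIV "\<lambda>_. F" t J] assms prob_space_F by auto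
  also have "\<dots> = distr (\<Pi>\<^sub>M i\<in>UNIV. F) (\<Pi>\<^sub>M j\<in>J. S) (\<lambda>\<omega>. \<lambda>n\<in>J. \<omega> (t n))"
    by (rule distr_cong) (simp_all add: sets)
  also have "\<dots> = distr M (\<Pi>\<^sub>M j\<in>J. S) (\<lambda>\<omega>. \<lambda>n\<in>J. X (t n) \<omega>)"
    unfolding joint[symmetric]
  proof (subst distr_distr)
    show "(\<lambda>\<omega>. \<lambda>n\<in>J. \<omega> (t n)) \<in> measurable (\<Pi>\<^sub>M i\<in>UNIV. S) (\<Pi>\<^sub>M j\<in>J. S)"
      by (intro measurable_restrict) simp
    show "(\<lambda>\<omega>. \<lambda>i\<in>UNIV. X i \<omega>) \<in> measurable M (\<Pi>\<^sub>M i\<in>UNIV. S)"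
      by (intro measurable_restrict) simp
  qed (simp add: comp_def)
  finally show ?thesis by simp
qed

lemma expectation_reindex:
  fixes f :: "('i \<Rightarrow> 'a) \<Rightarrow> real"
  assumes "inj_on s J" "inj_on t J" "f \<in> borel_measurable (\<Pi>\<^sub>M j\<in>J. S)"
  shows "(\<integral>\<omega>. f (\<lambda>j\<in>J. X (s j) \<omega>) \<partial>M) = (\<integral>\<omega>. f (\<lambda>j\<in>J. X (t j) \<omega>) \<partial>M)"
  using integral_distr[OF restrict_X_measurable assms(3), of s]
    integral_distr[OF restrict_X_measurable assms(3), of t]
  by (simp add: distr_reindexed_sample assms)

text \<open>
  Conditioning on the coordinates in \<open>J\<close>: the factor \<open>v\<close> is fixed by them, while the remaining coordinates of \<open>u\<close>
  are independent of them and are integrated out. Two independent blocks and Fubini's theorem replace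
  conditional expectations here. All orthogonality relations below are instances in which the inner integral vanishes.
\<close>

lemma expectation_condition:
  fixes u v :: "(nat \<Rightarrow> 'a) \<Rightarrow> real"
  assumes u [measurable]: "u \<in> borel_measurable (\<Pi>\<^sub>M i\<in>I. S)"
    and v [measurable]: "v \<in> borel_measurable (\<Pi>\<^sub>M i\<in>J. S)"
    and bounds: "\<And>x. \<bar>u x\<bar> \<le> B" "\<And>x. \<bar>v x\<bar> \<le> C"
  shows "(\<integral>\<omega>. u (\<lambda>i\<in>I. X i \<omega>) * v (\<lambda>i\<in>J. X i \<omega>) \<partial>M) =
    (\<integral>\<omega>'. v (\<lambda>i\<in>J. X i \<omega>') * (\<integral>\<omega>. u (\<lambda>i\<in>I. if i \<in> J then X i \<omega>' else X i \<omega>) \<partial>M) \<partial>M)"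
proof -
  let ?PJ = "\<Pi>\<^sub>M i\<in>J. S" and ?PK = "\<Pi>\<^sub>M i\<in>I - J. S"
  let ?A = "\<lambda>\<omega>. \<lambda>i\<in>J. X i \<omega>" and ?B = "\<lambda>\<omega>. \<lambda>i\<in>I - J. X i \<omega>"
  define f where "f = (\<lambda>(a, b). v a * u (\<lambda>i\<in>I. if i \<in> J then a i else b i :: 'a))"
  have A [measurable]: "?A \<in> measurable M ?PJ" and B [measurable]: "?B \<in> measurable M ?PK"
    by (rule restrict_X_measurable)+
  have merge: "(\<lambda>p. \<lambda>i\<in>I. if i \<in> J then fst p i else snd p i) \<in> measurable (?PJ \<Otimes>\<^sub>M ?PK) (\<Pi>\<^sub>M i\<in>I. S)"
  proof (intro measurable_restrict)
    fix i assume "i \<in> I"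
    then show "(\<lambda>p. if i \<in> J then fst p i else snd p i) \<in> measurable (?PJ \<Otimes>\<^sub>M ?PK) S"
      by (cases "i \<in> J") simp_all
  qed
  have f [measurable]: "f \<in> borel_measurable (?PJ \<Otimes>\<^sub>M ?PK)"
    unfolding f_def split_beta using measurable_compose[OF merge u] by measurable
  have f_bound: "norm (f p) \<le> C * B" for p
    using bounds order_trans[OF abs_ge_zero bounds(2)] unfolding f_def split_beta
    by (auto simp: abs_mult intro!: mult_mono)
  have ind: "indep_var ?PJ ?A ?PK ?B"
    by (rule indep_var_restrict[OF indep]) auto
  interpret PJ: prob_space "distr M ?PJ ?A" by (rule prob_space_distr) fact
  interpret PK: prob_space "distr M ?PK ?B" by (rule prob_space_distr) fact
  interpret PP: pair_prob_space "distr M ?PJ ?A" "distr M ?PK ?B" ..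
  have f': "f \<in> borel_measurable (distr M ?PJ ?A \<Otimes>\<^sub>M distr M ?PK ?B)" by simp
  have int: "integrable (distr M ?PJ ?A \<Otimes>\<^sub>M distr M ?PK ?B) f"
    by (rule PP.integrable_const_bound[of _ "C * B"]) (use f' f_bound in auto)
  have "(\<integral>\<omega>. u (\<lambda>i\<in>I. X i \<omega>) * v (\<lambda>i\<in>J. X i \<omega>) \<partial>M) = (\<integral>\<omega>. f (?A \<omega>, ?B \<omega>) \<partial>M)"
    unfolding f_def by (intro Bochner_Integration.integral_cong refl)
      (auto simp: mult.commute intro!: arg_cong[where f=u] arg_cong2[where f="(*)"])
  also have "\<dots> = (\<integral>p. f p \<partial>(distr M (?PJ \<Otimes>\<^sub>M ?PK) (\<lambda>\<omega>. (?A \<omega>, ?B \<omega>))))"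
    by (subst integral_distr) simp_all
  also have "\<dots> = (\<integral>p. f p \<partial>(distr M ?PJ ?A \<Otimes>\<^sub>M distr M ?PK ?B))"
    using ind by (simp add: indep_var_distribution_eq)
  also have "\<dots> = (\<integral>a. \<integral>b. f (a, b) \<partial>distr M ?PK ?B \<partial>distr M ?PJ ?A)"
    by (rule PP.integral_fst'[OF int, symmetric])
  also have "\<dots> = (\<integral>\<omega>'. \<integral>b. f (?A \<omega>', b) \<partial>distr M ?PK ?B \<partial>M)"
    by (rule integral_distr) (use PP.borel_measurable_lebesgue_integral in measurable)
  also have "\<dots> = (\<integral>\<omega>'. \<integral>\<omega>. f (?A \<omega>', ?B \<omega>) \<partial>M \<partial>M)"
  proof (intro Bochner_Integration.integral_cong refl)
    fix \<omega>' assume "\<omega>' \<in> space M"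
    then have "?A \<omega>' \<in> space ?PJ" using A by (meson measurable_space)
    then have "(\<lambda>b. f (?A \<omega>', b)) \<in> borel_measurable ?PK" by measurable
    then show "(\<integral>b. f (?A \<omega>', b) \<partial>distr M ?PK ?B) = (\<integral>\<omega>. f (?A \<omega>', ?B \<omega>) \<partial>M)"
      by (rule integral_distr[OF B])
  qed
  also have "\<dots> = (\<integral>\<omega>'. v (\<lambda>i\<in>J. X i \<omega>') *
      (\<integral>\<omega>. u (\<lambda>i\<in>I. if i \<in> J then X i \<omega>' else X i \<omega>) \<partial>M) \<partial>M)"
  proof (intro Bochner_Integration.integral_cong refl)
    fix \<omega>'
    have "(\<lambda>i\<in>I. if i \<in> J then ?A \<omega>' i else ?B \<omega> i) = (\<lambda>i\<in>I. if i \<in> J then X i \<omega>' else X i \<omega>)" for \<omega>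
      by auto
    then show "(\<integral>\<omega>. f (?A \<omega>', ?B \<omega>) \<partial>M) = v (\<lambda>i\<in>J. X i \<omega>') *
      (\<integral>\<omega>. u (\<lambda>i\<in>I. if i \<in> J then X i \<omega>' else X i \<omega>) \<partial>M)"
      by (simp add: f_def)
  qed
  finally show ?thesis .
qed

end

section \<open>Index sets and kernel values\<close>

lemma bij_betw_sorted_list_nth:
  assumes "finite I" "card I = m"
  shows "bij_betw (\<lambda>j. sorted_list_of_set I ! (j - 1)) {1..m} I"
proof -
  have "bij_betw (\<lambda>j. j - 1) {1..m} {..<m}"
    by (rule bij_betwI[where g=Suc]) auto
  moreover have "bij_betw (\<lambda>j. sorted_list_of_set I ! j) {..<m} I"
    using assms by (intro bij_betw_nth) auto
  ultimately show ?thesis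
    using bij_betw_trans by (fastforce simp: comp_def)
qed

lemma kernel_value_cong:
  assumes "finite I" "card I = m" "\<And>i. i \<in> I \<Longrightarrow> x i = y i"
  shows "kernel_value m k x I = kernel_value m k y I"
  unfolding kernel_value_def using bij_betwE[OF bij_betw_sorted_list_nth[OF assms(1,2)]] assms(3)
  by (intro arg_cong[where f=k]) auto

text \<open>
  Symmetry frees \<^const>\<open>kernel_value\<close> from the increasing enumeration of \<open>I\<close>: another
  enumeration differs from it by a permutation of \<open>{1..m}\<close>.
\<close>

lemma kernel_value_enumeration:
  assumes k: "symmetric_kernel S m k" and t: "bij_betw t {1..m} I"
    and x: "\<And>i. i \<in> I \<Longrightarrow> x i \<in> space S"
  shows "kernel_value m k x I = k (\<lambda>j\<in>{1..m}. x (t j))"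
proof -
  define s where "s j = sorted_list_of_set I ! (j - 1)" for j
  have I: "finite I" "card I = m" using t bij_betw_finite bij_betw_same_card[OF t] by auto
  have s: "bij_betw s {1..m} I"
    unfolding s_def using bij_betw_sorted_list_nth[OF I] .
  define \<pi> where "\<pi> j = (if j \<in> {1..m} then inv_into {1..m} s (t j) else j)" for j
  have "bij_betw (inv_into {1..m} s \<circ> t) {1..m} {1..m}"
    using bij_betw_trans[OF t bij_betw_inv_into[OF s]] .
  then have "bij_betw \<pi> {1..m} {1..m}"
    by (rule bij_betw_cong[THEN iffD1, rotated]) (simp add: \<pi>_def)
  then have \<pi>: "\<pi> permutes {1..m}"
    by (rule bij_imp_permutes) (auto simp: \<pi>_def)
  let ?y = "\<lambda>j\<in>{1..m}. x (s j)"
  have "?y \<in> space (\<Pi>\<^sub>M j\<in>{1..m}. S)"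
    using bij_betwE[OF s] x by (auto simp: space_PiM)
  then have "k (\<lambda>j\<in>{1..m}. ?y (\<pi> j)) = k ?y"
    using k \<pi> unfolding symmetric_kernel_def by blast
  moreover have "(\<lambda>j\<in>{1..m}. ?y (\<pi> j)) = (\<lambda>j\<in>{1..m}. x (t j))"
  proof (rule restrict_ext)
    fix j assume j: "j \<in> {1..m}"
    then have "\<pi> j \<in> {1..m}" using permutes_in_image[OF \<pi>] by simp
    moreover have "s (\<pi> j) = t j"
      using j bij_betwE[OF t] bij_betw_inv_into_right[OF s] by (simp add: \<pi>_def)
    ultimately show "?y (\<pi> j) = x (t j)" by simp
  qed
  ultimately show ?thesis by (simp add: kernel_value_def s_def)
qed

lemma kernel_value_measurable:
  assumes "k \<in> borel_measurable (\<Pi>\<^sub>M j\<in>{1..m}. S)" "finite I" "card I = m"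
  shows "(\<lambda>x. kernel_value m k x I) \<in> borel_measurable (\<Pi>\<^sub>M i\<in>I. S)"
  unfolding kernel_value_def
proof (rule measurable_compose[OF _ assms(1)], rule measurable_restrict)
  fix j assume "j \<in> {1..m}"
  then have "sorted_list_of_set I ! (j - 1) \<in> I"
    using bij_betwE[OF bij_betw_sorted_list_nth[OF assms(2,3)]] by blast
  then show "(\<lambda>x. x (sorted_list_of_set I ! (j - 1))) \<in> measurable (\<Pi>\<^sub>M i\<in>I. S) S"
    by (rule measurable_component_singleton)
qed

lemma (in iid_sample) kernel_value_sample_measurable:
  assumes "k \<in> borel_measurable (\<Pi>\<^sub>M j\<in>{1..m}. S)" "finite I" "card I = m"
  shows "(\<lambda>\<omega>. kernel_value m k (\<lambda>i. X i \<omega>) I) \<in> borel_measurable M"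
proof -
  have "(\<lambda>\<omega>. kernel_value m k (\<lambda>i\<in>I. X i \<omega>) I) \<in> borel_measurable M"
    by (rule measurable_compose[OF restrict_X_measurable kernel_value_measurable[OF assms]])
  then show ?thesis
    using kernel_value_cong[OF assms(2,3), of "\<lambda>i. X i _" "\<lambda>i\<in>I. X i _" k] by simp
qed

text \<open>
  Such a \<open>J\<close> contains an \<open>r\<close>-element subset \<open>A\<close> of \<open>I\<close>, and is then determined by \<open>A\<close> and the other \<open>m - r\<close> elements.
\<close>

lemma card_index_sets_overlap_le:
  assumes I: "I \<subseteq> {1..n}" "card I = m"
  shows "card {J. J \<subseteq> {1..n} \<and> card J = m \<and> r \<le> card (I \<inter> J)} \<le> (m choose r) * (n - r choose (m - r))"
proof (cases "r \<le> m")
  case False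
  have "finite I" using I(1) finite_subset by blast
  then have "card (I \<inter> J) \<le> m" for J using I(2) card_mono[of I "I \<inter> J"] by auto
  then have "\<not> r \<le> card (I \<inter> J)" for J using False order_trans by blast
  then show ?thesis by simp
next
  case True
  have fI: "finite I" using I(1) finite_subset by blast
  have fin: "finite {1..n}" by simp
  let ?R = "{A. A \<subseteq> I \<and> card A = r}" and ?E = "\<lambda>A. {B. B \<subseteq> {1..n} - A \<and> card B = m - r}"
  have "{J. J \<subseteq> {1..n} \<and> card J = m \<and> r \<le> card (I \<inter> J)} \<subseteq> (\<Union>A\<in>?R. (\<lambda>B. A \<union> B) ` ?E A)"
  proof
    fix J assume J: "J \<in> {J. J \<subseteq> {1..n} \<and> card J = m \<and> r \<le> card (I \<inter> J)}"
    then have fJ: "finite J" using finite_subset[OF _ fin] by blast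
    from J obtain A where A: "A \<subseteq> I \<inter> J" "card A = r"
      by (metis (no_types, lifting) mem_Collect_eq obtain_subset_with_card_n)
    then have "finite A" using fI finite_subset by blast
    then have "card (J - A) = m - r" using A J by (simp add: card_Diff_subset)
    then have "J - A \<in> ?E A" using J by auto
    moreover have "J = A \<union> (J - A)" using A by auto
    ultimately show "J \<in> (\<Union>A\<in>?R. (\<lambda>B. A \<union> B) ` ?E A)" using A by blast
  qed
  moreover have finE: "finite (?E A)" for A
    by (rule finite_subset[of _ "Pow {1..n}"]) auto
  moreover have finR: "finite ?R"
    using fI by simp
  ultimately have "card {J. J \<subseteq> {1..n} \<and> card J = m \<and> r \<le> card (I \<inter> J)}
      \<le> card (\<Union>A\<in>?R. (\<lambda>B. A \<union> B) ` ?E A)"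
    by (intro card_mono) auto
  also have "\<dots> \<le> (\<Sum>A\<in>?R. card ((\<lambda>B. A \<union> B) ` ?E A))"
    by (rule card_UN_le[OF finR])
  also have "\<dots> \<le> (\<Sum>A\<in>?R. n - r choose (m - r))"
  proof (rule sum_mono)
    fix A assume A: "A \<in> ?R"
    then have "A \<subseteq> {1..n}" "finite A" using I fI finite_subset by blast+
    then have "card ({1..n} - A) = n - r" using A by (simp add: card_Diff_subset)
    moreover have "card (?E A) = card ({1..n} - A) choose (m - r)"
      by (rule n_subsets) simp
    ultimately show "card ((\<lambda>B. A \<union> B) ` ?E A) \<le> n - r choose (m - r)"
      using card_image_le[OF finE, of "\<lambda>B. A \<union> B" A] by simp
  qed
  also have "\<dots> = (m choose r) * (n - r choose (m - r))"
    using n_subsets[OF fI, of r] I by simp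
  finally show ?thesis .
qed

abbreviation index_sets :: "nat \<Rightarrow> nat \<Rightarrow> nat set set" where
  "index_sets n m \<equiv> {I. I \<subseteq> {1..n} \<and> card I = m}"

lemma finite_index_sets: "finite (index_sets n m)"
  by (rule finite_subset[of _ "Pow {1..n}"]) auto

lemma card_index_sets: "card (index_sets n m) = n choose m"
  using n_subsets[of "{1..n}" m] by simp

lemma index_setsD:
  assumes "I \<in> index_sets n m" shows "finite I" "card I = m" "I \<subseteq> {1..n}"
  using assms finite_subset[of I "{1..n}"] by auto

text \<open>
  Every index lies in \<open>n - 1 choose (m - 1)\<close> of the index sets, and \<open>m * (n choose m) = n * (n - 1 choose (m - 1))\<close>.
\<close>

lemma sum_index_sets_additive:
  fixes g :: "nat \<Rightarrow> real"
  assumes "1 \<le> m" "m \<le> n"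
  shows "(\<Sum>I\<in>index_sets n m. \<Sum>i\<in>I. g i) / real (n choose m) = real m / real n * (\<Sum>i=1..n. g i)"
proof -
  have count: "card {I \<in> index_sets n m. i \<in> I} = n - 1 choose (m - 1)" if i: "i \<in> {1..n}" for i
  proof -
    have "bij_betw (insert i) {A. A \<subseteq> {1..n} - {i} \<and> card A = m - 1} {I \<in> index_sets n m. i \<in> I}"
    proof (rule bij_betwI[where g="\<lambda>I. I - {i}"])
      show "insert i \<in> {A. A \<subseteq> {1..n} - {i} \<and> card A = m - 1} \<rightarrow> {I \<in> index_sets n m. i \<in> I}"
      proof
        fix A assume A: "A \<in> {A. A \<subseteq> {1..n} - {i} \<and> card A = m - 1}"
        then have "finite A" using finite_subset[of A "{1..n} - {i}"] by auto
        moreover have "i \<notin> A" using A by auto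
        ultimately show "insert i A \<in> {I \<in> index_sets n m. i \<in> I}" using A i assms by auto
      qed
      show "(\<lambda>I. I - {i}) \<in> {I \<in> index_sets n m. i \<in> I} \<rightarrow> {A. A \<subseteq> {1..n} - {i} \<and> card A = m - 1}"
        by auto
    qed auto
    then have "card {I \<in> index_sets n m. i \<in> I} = card {A. A \<subseteq> {1..n} - {i} \<and> card A = m - 1}"
      by (simp add: bij_betw_same_card)
    also have "\<dots> = n - 1 choose (m - 1)"
      using i by (subst n_subsets) auto
    finally show ?thesis .
  qed
  have "(\<Sum>I\<in>index_sets n m. \<Sum>i\<in>I. g i) = (\<Sum>I\<in>index_sets n m. \<Sum>i\<in>{1..n}. if i \<in> I then g i else 0)"
  proof (rule sum.cong[OF refl])
    fix I assume "I \<in> index_sets n m"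
    then have "{i \<in> {1..n}. i \<in> I} = I" by auto
    then show "(\<Sum>i\<in>I. g i) = (\<Sum>i\<in>{1..n}. if i \<in> I then g i else 0)"
      using sum.inter_filter[where A="{1..n}" and g=g and P="\<lambda>i. i \<in> I"] by simp
  qed
  also have "\<dots> = (\<Sum>i\<in>{1..n}. \<Sum>I\<in>index_sets n m. if i \<in> I then g i else 0)"
    by (rule sum.swap)
  also have "\<dots> = (\<Sum>i\<in>{1..n}. real (n - 1 choose (m - 1)) * g i)"
  proof (rule sum.cong[OF refl])
    fix i assume i: "i \<in> {1..n}"
    have "(\<Sum>I\<in>index_sets n m. if i \<in> I then g i else 0) = (\<Sum>I\<in>{I \<in> index_sets n m. i \<in> I}. g i)"
      by (rule sum.inter_filter[OF finite_index_sets, symmetric])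
    also have "\<dots> = real (card {I \<in> index_sets n m. i \<in> I}) * g i" by (rule sum_constant)
    also have "card {I \<in> index_sets n m. i \<in> I} = n - 1 choose (m - 1)" by (rule count[OF i])
    finally show "(\<Sum>I\<in>index_sets n m. if i \<in> I then g i else 0) = real (n - 1 choose (m - 1)) * g i" .
  qed
  also have "\<dots> = real (n - 1 choose (m - 1)) * (\<Sum>i=1..n. g i)"
    by (simp add: sum_distrib_left)
  finally have *: "(\<Sum>I\<in>index_sets n m. \<Sum>i\<in>I. g i) = real (n - 1 choose (m - 1)) * (\<Sum>i=1..n. g i)" .
  have "m * (n choose m) = n * (n - 1 choose (m - 1))"
    using assms by (metis Suc_diff_le Suc_pred' binomial_absorption diff_Suc_1 le_trans less_le_trans zero_less_one One_nat_def le_add_diff_inverse plus_1_eq_Suc)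
  then have "real m * real (n choose m) = real n * real (n - 1 choose (m - 1))"
    by (metis of_nat_mult)
  moreover have "0 < real (n choose m)" "0 < real n" using assms by auto
  ultimately have "real (n - 1 choose (m - 1)) / real (n choose m) = real m / real n"
    by (simp add: field_simps)
  then show ?thesis using * by (metis times_divide_eq_left)
qed

text \<open>
  When the square of the average is expanded, only pairs of index sets with at least \<open>r\<close> common
  elements contribute. Counting them with \<open>card_index_sets_overlap_le\<close> and simplifying with
  \<open>(n choose m) * (m choose r) = (n choose r) * (n - r choose (m - r))\<close> gives a bound of order \<open>n\<^sup>-\<^sup>r\<close>. It is used with \<open>r = 1\<close> for
  the variance of a U-statistic and with \<open>r = 2\<close> for the remainder of its projection.
\<close>

lemma (in prob_space) second_moment_average_le:
  fixes Y :: "nat set \<Rightarrow> 'a \<Rightarrow> real"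
  assumes meas: "\<And>I. I \<in> index_sets n m \<Longrightarrow> Y I \<in> borel_measurable M"
    and bound: "\<And>I \<omega>. I \<in> index_sets n m \<Longrightarrow> \<bar>Y I \<omega>\<bar> \<le> B"
    and orth: "\<And>I J. I \<in> index_sets n m \<Longrightarrow> J \<in> index_sets n m \<Longrightarrow> card (I \<inter> J) < r \<Longrightarrow>
      (\<integral>\<omega>. Y I \<omega> * Y J \<omega> \<partial>M) = 0"
    and "m \<le> n"
  shows "(\<integral>\<omega>. ((\<Sum>I\<in>index_sets n m. Y I \<omega>) / real (n choose m))\<^sup>2 \<partial>M)
    \<le> B\<^sup>2 * (real (m choose r))\<^sup>2 / real (n choose r)"
proof -
  let ?I = "index_sets n m" and ?N = "real (n choose m)" and ?c = "real ((m choose r) * (n - r choose (m - r)))"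
  have N: "0 < ?N" using \<open>m \<le> n\<close> by simp
  have prod_bound: "\<bar>Y I \<omega> * Y J \<omega>\<bar> \<le> B\<^sup>2" if "I \<in> ?I" "J \<in> ?I" for I J \<omega>
    using bound[OF that(1), of \<omega>] bound[OF that(2), of \<omega>]
    by (auto simp: abs_mult power2_eq_square intro!: mult_mono)
  have int: "integrable M (\<lambda>\<omega>. Y I \<omega> * Y J \<omega>)" if "I \<in> ?I" "J \<in> ?I" for I J
    by (rule integrable_const_bound[of _ "B\<^sup>2"]) (use prod_bound meas that in auto)
  have term_le: "(\<integral>\<omega>. Y I \<omega> * Y J \<omega> \<partial>M) \<le> (if r \<le> card (I \<inter> J) then B\<^sup>2 else 0)"
    if "I \<in> ?I" "J \<in> ?I" for I J
  proof (cases "r \<le> card (I \<inter> J)")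
    case True
    have "(\<integral>\<omega>. Y I \<omega> * Y J \<omega> \<partial>M) \<le> (\<integral>\<omega>. B\<^sup>2 \<partial>M)"
      using prod_bound[OF that] by (intro integral_mono int that) (auto dest: order_trans[OF abs_ge_self])
    then show ?thesis using True by (simp add: prob_space)
  next
    case False
    then show ?thesis using orth[OF that] by simp
  qed
  have "(\<integral>\<omega>. ((\<Sum>I\<in>?I. Y I \<omega>) / ?N)\<^sup>2 \<partial>M) = (\<integral>\<omega>. (\<Sum>I\<in>?I. \<Sum>J\<in>?I. Y I \<omega> * Y J \<omega>) / ?N\<^sup>2 \<partial>M)"
    by (simp add: power_divide power2_eq_square sum_product)
  also have "\<dots> = (\<Sum>I\<in>?I. \<Sum>J\<in>?I. \<integral>\<omega>. Y I \<omega> * Y J \<omega> \<partial>M) / ?N\<^sup>2"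
  proof -
    have "(\<integral>\<omega>. (\<Sum>I\<in>?I. \<Sum>J\<in>?I. Y I \<omega> * Y J \<omega>) \<partial>M) = (\<Sum>I\<in>?I. \<integral>\<omega>. (\<Sum>J\<in>?I. Y I \<omega> * Y J \<omega>) \<partial>M)"
      by (intro Bochner_Integration.integral_sum Bochner_Integration.integrable_sum int)
    also have "\<dots> = (\<Sum>I\<in>?I. \<Sum>J\<in>?I. \<integral>\<omega>. Y I \<omega> * Y J \<omega> \<partial>M)"
      by (intro sum.cong refl Bochner_Integration.integral_sum int)
    finally show ?thesis by simp
  qed
  also have "\<dots> \<le> (\<Sum>I\<in>?I. B\<^sup>2 * ?c) / ?N\<^sup>2"
  proof (intro divide_right_mono sum_mono)
    fix I assume I: "I \<in> ?I"
    have "(\<Sum>J\<in>?I. \<integral>\<omega>. Y I \<omega> * Y J \<omega> \<partial>M) \<le> (\<Sum>J\<in>?I. if r \<le> card (I \<inter> J) then B\<^sup>2 else 0)"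
      using I by (intro sum_mono term_le)
    also have "\<dots> = (\<Sum>J\<in>{J \<in> ?I. r \<le> card (I \<inter> J)}. B\<^sup>2)"
      by (rule sum.inter_filter[symmetric]) (rule finite_index_sets)
    also have "\<dots> = B\<^sup>2 * real (card {J. J \<subseteq> {1..n} \<and> card J = m \<and> r \<le> card (I \<inter> J)})"
      by (simp add: conj_assoc mult.commute)
    also have "\<dots> \<le> B\<^sup>2 * ?c"
      using I by (intro mult_left_mono of_nat_mono card_index_sets_overlap_le) auto
    finally show "(\<Sum>J\<in>?I. \<integral>\<omega>. Y I \<omega> * Y J \<omega> \<partial>M) \<le> B\<^sup>2 * ?c" .
  qed simp
  also have "\<dots> = B\<^sup>2 * (?c / ?N)"
    using N card_index_sets[of n m] by (simp add: power2_eq_square)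
  also have "?c / ?N = (real (m choose r))\<^sup>2 / real (n choose r)"
  proof (cases "r \<le> m")
    case True
    have "(n choose m) * (m choose r) = (n choose r) * (n - r choose (m - r))"
      using True \<open>m \<le> n\<close> by (rule choose_mult)
    then have "?N * real (m choose r) = real (n choose r) * real (n - r choose (m - r))"
      by (metis of_nat_mult)
    moreover have "0 < real (n choose r)" using True \<open>m \<le> n\<close> by simp
    ultimately show ?thesis using N by (simp add: field_simps power2_eq_square)
  qed (simp add: binomial_eq_0)
  finally show ?thesis by simp
qed

section \<open>U-statistics with bounded kernels\<close>

locale bounded_kernel = iid_sample M S F X
  for M :: "'b measure" and S F :: "'a measure" and X :: "nat \<Rightarrow> 'b \<Rightarrow> 'a" +
  fixes m :: nat and k :: "(nat \<Rightarrow> 'a) \<Rightarrow> real" and B :: real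
  assumes degree_pos: "1 \<le> m"
    and kernel_measurable: "k \<in> borel_measurable (\<Pi>\<^sub>M j\<in>{1..m}. S)"
    and kernel_symmetric: "symmetric_kernel S m k"
    and kernel_bounded: "\<And>x. \<bar>k x\<bar> \<le> B"
begin

definition kernel_mean :: real where
  "kernel_mean = (\<integral>\<omega>. k (\<lambda>j\<in>{1..m}. X j \<omega>) \<partial>M)"

definition kernel_proj :: "'a \<Rightarrow> real" where
  "kernel_proj x = (\<integral>\<omega>. kernel_section X m k x \<omega> \<partial>M)"

definition U_stat :: "nat \<Rightarrow> 'b \<Rightarrow> real" where
  "U_stat n \<omega> = (\<Sum>I\<in>index_sets n m. kernel_value m k (\<lambda>i. X i \<omega>) I) / real (n choose m)"

lemma bound_nonneg: "0 \<le> B"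
  using kernel_bounded[of undefined] by linarith

lemma kernel_value_bounded: "\<bar>kernel_value m k x I\<bar> \<le> B"
  by (simp add: kernel_value_def kernel_bounded)

lemma integrable_kernel_value:
  assumes "finite I" "card I = m"
  shows "integrable M (\<lambda>\<omega>. kernel_value m k (\<lambda>i. X i \<omega>) I)"
  by (rule integrable_const_bound[of _ B])
    (use kernel_value_bounded kernel_value_sample_measurable[OF kernel_measurable assms] in auto)

lemma U_stat_measurable [measurable]: "U_stat n \<in> borel_measurable M"
proof -
  have "(\<lambda>\<omega>. \<Sum>I\<in>index_sets n m. kernel_value m k (\<lambda>i. X i \<omega>) I) \<in> borel_measurable M"
    by (rule borel_measurable_sum, rule kernel_value_sample_measurable[OF kernel_measurable]) (erule index_setsD)+
  then show ?thesis unfolding U_stat_def by measurable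
qed

lemma kernel_section_measurable:
  "(\<lambda>(x, \<omega>). kernel_section X m k x \<omega>) \<in> borel_measurable (S \<Otimes>\<^sub>M M)"
  unfolding kernel_section_def split_beta
proof (rule measurable_compose[OF _ kernel_measurable], rule measurable_restrict)
  fix j assume "j \<in> {1..m}"
  show "(\<lambda>p. if j = 1 then fst p else X j (snd p)) \<in> measurable (S \<Otimes>\<^sub>M M) S"
    by (cases "j = 1") simp_all
qed

lemma kernel_proj_measurable [measurable]: "kernel_proj \<in> borel_measurable S"
  using borel_measurable_lebesgue_integral[OF kernel_section_measurable]
  by (simp add: kernel_proj_def[abs_def])

lemma kernel_proj_bounded: "\<bar>kernel_proj x\<bar> \<le> B"
proof (cases "integrable M (kernel_section X m k x)")
  case True
  have "\<bar>kernel_proj x\<bar> \<le> (\<integral>\<omega>. \<bar>kernel_section X m k x \<omega>\<bar> \<partial>M)"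
    unfolding kernel_proj_def by (rule integral_abs_bound)
  also have "\<dots> \<le> (\<integral>\<omega>. B \<partial>M)"
    by (intro integral_mono integrable_abs[OF True]) (auto simp: kernel_section_def kernel_bounded)
  finally show ?thesis by (simp add: prob_space)
next
  case False
  then show ?thesis by (simp add: kernel_proj_def not_integrable_integral_eq bound_nonneg)
qed

lemma kernel_mean_bounded: "\<bar>kernel_mean\<bar> \<le> B"
proof -
  have "(\<lambda>\<omega>. k (\<lambda>j\<in>{1..m}. X j \<omega>)) \<in> borel_measurable M"
    by (rule measurable_compose[OF restrict_X_measurable kernel_measurable])
  then have int: "integrable M (\<lambda>\<omega>. k (\<lambda>j\<in>{1..m}. X j \<omega>))"
    by (intro integrable_const_bound[of _ B]) (auto simp: kernel_bounded)
  have "\<bar>kernel_mean\<bar> \<le> (\<integral>\<omega>. \<bar>k (\<lambda>j\<in>{1..m}. X j \<omega>)\<bar> \<partial>M)"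
    unfolding kernel_mean_def by (rule integral_abs_bound)
  also have "\<dots> \<le> (\<integral>\<omega>. B \<partial>M)"
    using int by (intro integral_mono) (auto simp: kernel_bounded)
  finally show ?thesis by (simp add: prob_space)
qed

lemma expectation_kernel_value:
  assumes "finite I" "card I = m"
  shows "(\<integral>\<omega>. kernel_value m k (\<lambda>i. X i \<omega>) I \<partial>M) = kernel_mean"
proof -
  have "inj_on (\<lambda>j. sorted_list_of_set I ! (j - 1)) {1..m}"
    using bij_betw_sorted_list_nth[OF assms] by (rule bij_betw_imp_inj_on)
  from expectation_reindex[OF this inj_on_id2[of "{1..m}"] kernel_measurable]
  show ?thesis by (simp add: kernel_value_def kernel_mean_def)
qed

text \<open>
  The definition of \<^const>\<open>kernel_section\<close> puts the fixed point first. By symmetry, \<open>I\<close> may be enumerated so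
  that \<open>i\<close> comes first as well, and the other observations may be replaced by \<open>X 2, \<dots>, X m\<close>.
\<close>

lemma expectation_kernel_value_fixed_point:
  assumes I: "finite I" "card I = m" "i \<in> I" and z: "z \<in> space S"
  shows "(\<integral>\<omega>. kernel_value m k (\<lambda>j. if j = i then z else X j \<omega>) I \<partial>M) = kernel_proj z"
proof -
  obtain t0 where t0: "bij_betw t0 {2..m} (I - {i})"
    using I finite_same_card_bij[of "{2..m}" "I - {i}"] by auto
  define t where "t = t0(1 := i)"
  have t_img: "bij_betw t {2..m} (I - {i})"
    using t0 by (rule bij_betw_cong[THEN iffD1, rotated]) (simp add: t_def)
  have "bij_betw t ({2..m} \<union> {1}) ((I - {i}) \<union> {i})"
    by (rule bij_betw_combine[OF t_img]) (auto simp: t_def bij_betw_def)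
  moreover have "{2..m} \<union> {1} = {1..m}" "(I - {i}) \<union> {i} = I"
    using degree_pos I by auto
  ultimately have t: "bij_betw t {1..m} I" by simp
  have t1: "t j = i \<longleftrightarrow> j = 1" if "j \<in> {1..m}" for j
    using that bij_betwE[OF t_img] by (cases "j = 1") (auto simp: t_def)
  let ?f = "\<lambda>y. k (\<lambda>j\<in>{1..m}. if j = 1 then z else y j)"
  have f: "?f \<in> borel_measurable (\<Pi>\<^sub>M j\<in>{2..m}. S)"
  proof (rule measurable_compose[OF _ kernel_measurable], rule measurable_restrict)
    fix j assume "j \<in> {1..m}"
    then show "(\<lambda>y. if j = 1 then z else y j) \<in> measurable (\<Pi>\<^sub>M j\<in>{2..m}. S) S"
      using z by (cases "j = 1") auto
  qed
  have "(\<integral>\<omega>. kernel_value m k (\<lambda>j. if j = i then z else X j \<omega>) I \<partial>M)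
      = (\<integral>\<omega>. ?f (\<lambda>j\<in>{2..m}. X (t j) \<omega>) \<partial>M)"
  proof (intro Bochner_Integration.integral_cong refl)
    fix \<omega> assume "\<omega> \<in> space M"
    then have "kernel_value m k (\<lambda>j. if j = i then z else X j \<omega>) I
        = k (\<lambda>j\<in>{1..m}. if t j = i then z else X (t j) \<omega>)"
      using z by (intro kernel_value_enumeration[OF kernel_symmetric t]) (auto simp: X_in_space)
    also have "(\<lambda>j\<in>{1..m}. if t j = i then z else X (t j) \<omega>)
        = (\<lambda>j\<in>{1..m}. if j = 1 then z else (\<lambda>j\<in>{2..m}. X (t j) \<omega>) j)"
      by (rule restrict_ext) (auto simp: t1)
    finally show "kernel_value m k (\<lambda>j. if j = i then z else X j \<omega>) I = ?f (\<lambda>j\<in>{2..m}. X (t j) \<omega>)" .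
  qed
  also have "\<dots> = (\<integral>\<omega>. ?f (\<lambda>j\<in>{2..m}. X j \<omega>) \<partial>M)"
    using expectation_reindex[OF bij_betw_imp_inj_on[OF t_img] inj_on_id2 f] by simp
  also have "\<dots> = kernel_proj z"
    unfolding kernel_proj_def kernel_section_def
    by (intro Bochner_Integration.integral_cong refl arg_cong[where f=k] restrict_ext) auto
  finally show ?thesis .
qed

lemma integrable_kernel_proj: "integrable M (\<lambda>\<omega>. kernel_proj (X i \<omega>))"
  by (rule integrable_const_bound[of _ B]) (auto simp: kernel_proj_bounded)

lemma expectation_kernel_proj: "(\<integral>\<omega>. kernel_proj (X i \<omega>) \<partial>M) = kernel_mean"
proof -
  have "(\<integral>\<omega>. kernel_proj (X i \<omega>) \<partial>M) = (\<integral>\<omega>. kernel_proj (X 1 \<omega>) \<partial>M)"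
    using integral_distr[of "X i" M S kernel_proj] integral_distr[of "X 1" M S kernel_proj]
    by (simp add: distr_X)
  also have "\<dots> = (\<integral>\<omega>'. 1 * (\<integral>\<omega>. k (\<lambda>j\<in>{1..m}. if j \<in> {1} then X j \<omega>' else X j \<omega>) \<partial>M) \<partial>M)"
    unfolding kernel_proj_def kernel_section_def
    by (intro Bochner_Integration.integral_cong refl) (auto intro!: Bochner_Integration.integral_cong arg_cong[where f=k])
  also have "\<dots> = (\<integral>\<omega>. k (\<lambda>j\<in>{1..m}. X j \<omega>) * 1 \<partial>M)"
    using expectation_condition[OF kernel_measurable, of "\<lambda>_. 1" "{1}" B 1] kernel_bounded by simp
  finally show ?thesis by (simp add: kernel_mean_def)
qed

text \<open>
  The part of a kernel value that is left after its mean and its first-order projections are removed, as in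
  Hoeffding's decomposition.
\<close>

definition residual :: "nat set \<Rightarrow> (nat \<Rightarrow> 'a) \<Rightarrow> real" where
  "residual I x = kernel_value m k x I - kernel_mean - (\<Sum>i\<in>I. kernel_proj (x i) - kernel_mean)"

lemma residual_cong:
  assumes "finite I" "card I = m" "\<And>i. i \<in> I \<Longrightarrow> x i = y i"
  shows "residual I x = residual I y"
  using kernel_value_cong[OF assms] assms(3) by (simp add: residual_def)

lemma residual_measurable:
  assumes "finite I" "card I = m"
  shows "residual I \<in> borel_measurable (\<Pi>\<^sub>M i\<in>I. S)"
proof -
  have "(\<lambda>x. kernel_proj (x i)) \<in> borel_measurable (\<Pi>\<^sub>M i\<in>I. S)" if "i \<in> I" for i
    by (rule measurable_compose[OF measurable_component_singleton[OF that] kernel_proj_measurable])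
  then show ?thesis
    unfolding residual_def[abs_def]
    by (intro borel_measurable_diff borel_measurable_sum borel_measurable_const
        kernel_value_measurable[OF kernel_measurable assms]) auto
qed

lemma residual_bounded:
  assumes "card I = m"
  shows "\<bar>residual I x\<bar> \<le> 2 * B * (real m + 1)"
proof -
  have "\<bar>\<Sum>i\<in>I. kernel_proj (x i) - kernel_mean\<bar> \<le> (\<Sum>i\<in>I. \<bar>kernel_proj (x i) - kernel_mean\<bar>)"
    by (rule sum_abs)
  also have "\<dots> \<le> (\<Sum>i\<in>I. 2 * B)"
  proof (rule sum_mono)
    fix i show "\<bar>kernel_proj (x i) - kernel_mean\<bar> \<le> 2 * B"
      using kernel_proj_bounded[of "x i"] kernel_mean_bounded by linarith
  qed
  also have "\<dots> = 2 * B * real m" using assms by simp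
  finally have "\<bar>\<Sum>i\<in>I. kernel_proj (x i) - kernel_mean\<bar> \<le> 2 * B * real m" .
  then show ?thesis
    using kernel_value_bounded[of x I] kernel_mean_bounded unfolding residual_def distrib_left by linarith
qed

text \<open>
  If the observations with index in \<open>J\<close> are frozen and \<open>J\<close> meets \<open>I\<close> only in \<open>i\<close>, then the kernel value averages to
  \<open>kernel_proj (X i \<omega>')\<close>. This is exactly what the sum over \<open>I\<close> subtracts, because its other
  terms have mean zero.
\<close>

lemma expectation_residual_given_overlap:
  assumes I: "finite I" "card I = m" and overlap: "card (I \<inter> J) < 2" and \<omega>': "\<omega>' \<in> space M"
  shows "(\<integral>\<omega>. residual I (\<lambda>i. if i \<in> J then X i \<omega>' else X i \<omega>) \<partial>M) = 0"
proof (cases "I \<inter> J = {}")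
  case True
  have "(\<integral>\<omega>. residual I (\<lambda>i. if i \<in> J then X i \<omega>' else X i \<omega>) \<partial>M) = (\<integral>\<omega>. residual I (\<lambda>i. X i \<omega>) \<partial>M)"
    using True I by (intro Bochner_Integration.integral_cong refl residual_cong) auto
  also have "\<dots> = 0"
    unfolding residual_def using I
    by (simp add: integrable_kernel_value integrable_kernel_proj expectation_kernel_value
        expectation_kernel_proj prob_space Bochner_Integration.integral_sum)
  finally show ?thesis .
next
  case False
  then have "card (I \<inter> J) = 1" using overlap I by (metis One_nat_def card_gt_0_iff finite_Int less_2_cases nat_neq_iff)
  then obtain i where i: "I \<inter> J = {i}" by (rule card_1_singletonE)
  define z where "z = X i \<omega>'"
  have z: "z \<in> space S" using \<omega>' by (simp add: z_def X_in_space)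
  have iI: "i \<in> I" using i by auto
  let ?x = "\<lambda>\<omega> j. if j = i then z else X j \<omega>"
  have int: "integrable M (\<lambda>\<omega>. kernel_value m k (?x \<omega>) I)"
  proof -
    have "(\<lambda>\<omega>. \<lambda>j\<in>I. ?x \<omega> j) \<in> measurable M (\<Pi>\<^sub>M i\<in>I. S)"
    proof (rule measurable_restrict)
      fix j show "(\<lambda>\<omega>. ?x \<omega> j) \<in> measurable M S" using z by (cases "j = i") auto
    qed
    from measurable_compose[OF this kernel_value_measurable[OF kernel_measurable I]]
    have "(\<lambda>\<omega>. kernel_value m k (?x \<omega>) I) \<in> borel_measurable M"
      using kernel_value_cong[OF I, of "?x _" "\<lambda>j\<in>I. ?x _ j" k] by simp
    then show ?thesis
      by (intro integrable_const_bound[of _ B]) (auto simp: kernel_value_bounded)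
  qed
  have "(\<integral>\<omega>. residual I (\<lambda>i. if i \<in> J then X i \<omega>' else X i \<omega>) \<partial>M) = (\<integral>\<omega>. residual I (?x \<omega>) \<partial>M)"
    using i by (intro Bochner_Integration.integral_cong refl residual_cong I) (auto simp: z_def)
  also have "\<dots> = (\<integral>\<omega>. kernel_value m k (?x \<omega>) I - kernel_mean
      - ((kernel_proj z - kernel_mean) + (\<Sum>j\<in>I - {i}. kernel_proj (X j \<omega>) - kernel_mean)) \<partial>M)"
  proof (intro Bochner_Integration.integral_cong refl)
    fix \<omega>
    have "(\<Sum>j\<in>I - {i}. kernel_proj (?x \<omega> j) - kernel_mean) = (\<Sum>j\<in>I - {i}. kernel_proj (X j \<omega>) - kernel_mean)"
      by (rule sum.cong) auto
    then show "residual I (?x \<omega>) = kernel_value m k (?x \<omega>) I - kernel_mean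
      - ((kernel_proj z - kernel_mean) + (\<Sum>j\<in>I - {i}. kernel_proj (X j \<omega>) - kernel_mean))"
      unfolding residual_def using sum.remove[OF I(1) iI, of "\<lambda>j. kernel_proj (?x \<omega> j) - kernel_mean"]
      by simp
  qed
  also have "\<dots> = 0"
    using int expectation_kernel_value_fixed_point[OF I iI z]
    by (simp add: integrable_kernel_proj expectation_kernel_proj prob_space Bochner_Integration.integral_sum)
  finally show ?thesis .
qed

lemma residuals_orthogonal:
  assumes I: "finite I" "card I = m" and J: "finite J" "card J = m" and overlap: "card (I \<inter> J) < 2"
  shows "(\<integral>\<omega>. residual I (\<lambda>i. X i \<omega>) * residual J (\<lambda>i. X i \<omega>) \<partial>M) = 0"
proof -
  have "(\<integral>\<omega>. residual I (\<lambda>i. X i \<omega>) * residual J (\<lambda>i. X i \<omega>) \<partial>M)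
      = (\<integral>\<omega>. residual I (\<lambda>i\<in>I. X i \<omega>) * residual J (\<lambda>i\<in>J. X i \<omega>) \<partial>M)"
    using I J by (intro Bochner_Integration.integral_cong refl arg_cong2[where f="(*)"] residual_cong) auto
  also have "\<dots> = (\<integral>\<omega>'. residual J (\<lambda>i\<in>J. X i \<omega>') *
      (\<integral>\<omega>. residual I (\<lambda>i\<in>I. if i \<in> J then X i \<omega>' else X i \<omega>) \<partial>M) \<partial>M)"
    by (rule expectation_condition[OF residual_measurable[OF I] residual_measurable[OF J]
          residual_bounded[OF I(2)] residual_bounded[OF J(2)]])
  also have "\<dots> = (\<integral>\<omega>'. 0 \<partial>M)"
  proof (intro Bochner_Integration.integral_cong refl)
    fix \<omega>' assume "\<omega>' \<in> space M"
    have "(\<integral>\<omega>. residual I (\<lambda>i\<in>I. if i \<in> J then X i \<omega>' else X i \<omega>) \<partial>M)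
        = (\<integral>\<omega>. residual I (\<lambda>i. if i \<in> J then X i \<omega>' else X i \<omega>) \<partial>M)"
      using I by (intro Bochner_Integration.integral_cong refl residual_cong) auto
    then show "residual J (\<lambda>i\<in>J. X i \<omega>') *
      (\<integral>\<omega>. residual I (\<lambda>i\<in>I. if i \<in> J then X i \<omega>' else X i \<omega>) \<partial>M) = 0"
      using expectation_residual_given_overlap[OF I overlap \<open>\<omega>' \<in> space M\<close>] by simp
  qed
  finally show ?thesis by simp
qed

lemma kernel_values_uncorrelated:
  assumes I: "finite I" "card I = m" and J: "finite J" "card J = m" and disj: "I \<inter> J = {}"
  shows "(\<integral>\<omega>. (kernel_value m k (\<lambda>i. X i \<omega>) I - kernel_mean) *
    (kernel_value m k (\<lambda>i. X i \<omega>) J - kernel_mean) \<partial>M) = 0"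
proof -
  let ?u = "\<lambda>I x. kernel_value m k x I - kernel_mean"
  have cong: "?u I x = ?u I y" if "finite I" "card I = m" "\<And>i. i \<in> I \<Longrightarrow> x i = y i" for I x y
    using kernel_value_cong[OF that] by simp
  have meas: "?u I \<in> borel_measurable (\<Pi>\<^sub>M i\<in>I. S)" if "finite I" "card I = m" for I
    by (intro borel_measurable_diff borel_measurable_const kernel_value_measurable[OF kernel_measurable that])
  have bound: "\<bar>?u I x\<bar> \<le> 2 * B" for I x
    using kernel_value_bounded[of x I] kernel_mean_bounded by linarith
  have "(\<integral>\<omega>. ?u I (\<lambda>i. X i \<omega>) * ?u J (\<lambda>i. X i \<omega>) \<partial>M)
      = (\<integral>\<omega>. ?u I (\<lambda>i\<in>I. X i \<omega>) * ?u J (\<lambda>i\<in>J. X i \<omega>) \<partial>M)"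
    using I J by (intro Bochner_Integration.integral_cong refl arg_cong2[where f="(*)"] cong) auto
  also have "\<dots> = (\<integral>\<omega>'. ?u J (\<lambda>i\<in>J. X i \<omega>') *
      (\<integral>\<omega>. ?u I (\<lambda>i\<in>I. if i \<in> J then X i \<omega>' else X i \<omega>) \<partial>M) \<partial>M)"
    by (rule expectation_condition[OF meas[OF I] meas[OF J] bound bound])
  also have "\<dots> = (\<integral>\<omega>'. ?u J (\<lambda>i\<in>J. X i \<omega>') * (\<integral>\<omega>. ?u I (\<lambda>i. X i \<omega>) \<partial>M) \<partial>M)"
    using I disj by (intro Bochner_Integration.integral_cong refl arg_cong2[where f="(*)"] cong) auto
  also have "(\<integral>\<omega>. ?u I (\<lambda>i. X i \<omega>) \<partial>M) = 0"
    using I by (simp add: integrable_kernel_value expectation_kernel_value prob_space)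
  finally show ?thesis by simp
qed

lemma U_stat_minus_mean_eq:
  assumes "m \<le> n"
  shows "U_stat n \<omega> - kernel_mean =
    (\<Sum>I\<in>index_sets n m. kernel_value m k (\<lambda>i. X i \<omega>) I - kernel_mean) / real (n choose m)"
proof -
  have "real (n choose m) \<noteq> 0" using assms by simp
  then show ?thesis
    using card_index_sets[of n m] by (simp add: U_stat_def sum_subtractf diff_divide_distrib)
qed

lemma U_stat_variance_le:
  assumes "m \<le> n"
  shows "(\<integral>\<omega>. (U_stat n \<omega> - kernel_mean)\<^sup>2 \<partial>M) \<le> (2 * B)\<^sup>2 * (real m)\<^sup>2 / real n"
proof -
  have "(\<integral>\<omega>. (U_stat n \<omega> - kernel_mean)\<^sup>2 \<partial>M)
      \<le> (2 * B)\<^sup>2 * (real (m choose 1))\<^sup>2 / real (n choose 1)"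
    unfolding U_stat_minus_mean_eq[OF assms]
  proof (rule second_moment_average_le[OF _ _ _ assms])
    fix I assume I: "I \<in> index_sets n m"
    note I' = index_setsD(1,2)[OF I]
    show "(\<lambda>\<omega>. kernel_value m k (\<lambda>i. X i \<omega>) I - kernel_mean) \<in> borel_measurable M"
      using kernel_value_sample_measurable[OF kernel_measurable I'] by measurable
    show "\<bar>kernel_value m k (\<lambda>i. X i \<omega>) I - kernel_mean\<bar> \<le> 2 * B" for \<omega>
      using kernel_value_bounded[of "\<lambda>i. X i \<omega>" I] kernel_mean_bounded by linarith
    fix J assume J: "J \<in> index_sets n m" and "card (I \<inter> J) < 1"
    then have "I \<inter> J = {}" using I' by simp
    then show "(\<integral>\<omega>. (kernel_value m k (\<lambda>i. X i \<omega>) I - kernel_mean) *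
        (kernel_value m k (\<lambda>i. X i \<omega>) J - kernel_mean) \<partial>M) = 0"
      by (rule kernel_values_uncorrelated[OF I' index_setsD(1,2)[OF J]])
  qed
  then show ?thesis by simp
qed

text \<open>
  What the Hajek projection, the best approximation by a sum of functions of single observations, leaves of the U-statistic.
\<close>

definition hajek_remainder :: "nat \<Rightarrow> 'b \<Rightarrow> real" where
  "hajek_remainder n \<omega> = U_stat n \<omega> - kernel_mean
     - real m / real n * (\<Sum>i=1..n. kernel_proj (X i \<omega>) - kernel_mean)"

lemma hajek_remainder_measurable [measurable]: "hajek_remainder n \<in> borel_measurable M"
  unfolding hajek_remainder_def[abs_def] by measurable

lemma hajek_remainder_second_moment_le:
  assumes "m \<le> n"
  shows "(\<integral>\<omega>. (hajek_remainder n \<omega>)\<^sup>2 \<partial>M)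
    \<le> (2 * B * (real m + 1))\<^sup>2 * (real (m choose 2))\<^sup>2 / real (n choose 2)"
proof -
  have eq: "hajek_remainder n \<omega> = (\<Sum>I\<in>index_sets n m. residual I (\<lambda>i. X i \<omega>)) / real (n choose m)" for \<omega>
    unfolding hajek_remainder_def U_stat_minus_mean_eq[OF assms]
      sum_index_sets_additive[OF degree_pos assms, symmetric]
    by (simp add: residual_def sum_subtractf diff_divide_distrib)
  show ?thesis
    unfolding eq
  proof (rule second_moment_average_le[OF _ _ _ assms])
    fix I assume I: "I \<in> index_sets n m"
    note I' = index_setsD(1,2)[OF I]
    have "(\<lambda>\<omega>. residual I (\<lambda>i\<in>I. X i \<omega>)) \<in> borel_measurable M"
      by (rule measurable_compose[OF restrict_X_measurable residual_measurable[OF I']])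
    then show "(\<lambda>\<omega>. residual I (\<lambda>i. X i \<omega>)) \<in> borel_measurable M"
      using residual_cong[OF I', of "\<lambda>i. X i _" "\<lambda>i\<in>I. X i _"] by simp
    show "\<bar>residual I (\<lambda>i. X i \<omega>)\<bar> \<le> 2 * B * (real m + 1)" for \<omega>
      by (rule residual_bounded[OF I'(2)])
    fix J assume J: "J \<in> index_sets n m" and "card (I \<inter> J) < 2"
    then show "(\<integral>\<omega>. residual I (\<lambda>i. X i \<omega>) * residual J (\<lambda>i. X i \<omega>) \<partial>M) = 0"
      by (intro residuals_orthogonal[OF I' index_setsD(1,2)[OF J]])
  qed
qed

lemma U_stat_bounded: "\<bar>U_stat n \<omega>\<bar> \<le> B"
proof (cases "m \<le> n")
  case True
  then have N: "0 < real (n choose m)" by simp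
  have "\<bar>\<Sum>I\<in>index_sets n m. kernel_value m k (\<lambda>i. X i \<omega>) I\<bar> \<le> (\<Sum>I\<in>index_sets n m. B)"
    by (rule order_trans[OF sum_abs sum_mono]) (rule kernel_value_bounded)
  also have "\<dots> = B * real (n choose m)" using card_index_sets[of n m] by simp
  finally show ?thesis using N by (simp add: U_stat_def field_simps)
next
  case False
  then show ?thesis by (simp add: U_stat_def binomial_eq_0 bound_nonneg)
qed

lemma U_stat_minus_mean_bounded: "\<bar>U_stat n \<omega> - kernel_mean\<bar> \<le> 2 * B"
  using U_stat_bounded[of n \<omega>] kernel_mean_bounded by linarith

lemma integrable_scaled_U_stat_power2: "integrable M (\<lambda>\<omega>. (c * (U_stat n \<omega> - kernel_mean))\<^sup>2)"
proof (rule integrable_const_bound[of _ "(\<bar>c\<bar> * (2 * B))\<^sup>2"])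
  have "\<bar>c * (U_stat n \<omega> - kernel_mean)\<bar> \<le> \<bar>c\<bar> * (2 * B)" for \<omega>
    unfolding abs_mult by (intro mult_left_mono U_stat_minus_mean_bounded) simp
  from power_mono[OF this abs_ge_zero, of _ 2]
  have "(c * (U_stat n \<omega> - kernel_mean))\<^sup>2 \<le> (\<bar>c\<bar> * (2 * B))\<^sup>2" for \<omega>
    by (simp only: power2_abs)
  then show "AE \<omega> in M. norm ((c * (U_stat n \<omega> - kernel_mean))\<^sup>2) \<le> (\<bar>c\<bar> * (2 * B))\<^sup>2"
    by simp
qed measurable

lemma scaled_U_stat_second_moment_le:
  assumes "m \<le> n"
  shows "(\<integral>\<omega>. (sqrt (real n) * (U_stat n \<omega> - kernel_mean))\<^sup>2 \<partial>M) \<le> (2 * B)\<^sup>2 * (real m)\<^sup>2"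
proof -
  have n: "0 < real n" using assms degree_pos by auto
  have "(\<integral>\<omega>. (sqrt (real n) * (U_stat n \<omega> - kernel_mean))\<^sup>2 \<partial>M)
      = real n * (\<integral>\<omega>. (U_stat n \<omega> - kernel_mean)\<^sup>2 \<partial>M)"
    by (simp add: power_mult_distrib)
  also have "\<dots> \<le> real n * ((2 * B)\<^sup>2 * (real m)\<^sup>2 / real n)"
    by (intro mult_left_mono U_stat_variance_le assms) simp
  finally show ?thesis using n by simp
qed

lemma U_stat_consistent: "tends_to_zero_in_prob (\<lambda>n \<omega>. U_stat n \<omega> - kernel_mean)"
proof (rule tends_to_zero_in_prob_if_second_moment)
  show "integrable M (\<lambda>\<omega>. (U_stat n \<omega> - kernel_mean)\<^sup>2)" for n
    using integrable_scaled_U_stat_power2[of 1] by simp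
  have "(\<lambda>n. (2 * B)\<^sup>2 * (real m)\<^sup>2 / real n) \<longlonglongrightarrow> 0"
    by (rule lim_const_over_n)
  then show "(\<lambda>n. \<integral>\<omega>. (U_stat n \<omega> - kernel_mean)\<^sup>2 \<partial>M) \<longlonglongrightarrow> 0"
    by (rule Lim_null_comparison[OF eventually_mono[OF eventually_ge_at_top[of m]], rotated])
      (use U_stat_variance_le in simp)
qed measurable

lemma hajek_remainder_bounded: "\<bar>hajek_remainder n \<omega>\<bar> \<le> 2 * B * (real m + 1)"
proof -
  have "\<bar>\<Sum>i=1..n. kernel_proj (X i \<omega>) - kernel_mean\<bar> \<le> (\<Sum>i=1..n. \<bar>kernel_proj (X i \<omega>) - kernel_mean\<bar>)"
    by (rule sum_abs)
  also have "\<dots> \<le> (\<Sum>i=1..n. 2 * B)"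
  proof (rule sum_mono)
    fix i show "\<bar>kernel_proj (X i \<omega>) - kernel_mean\<bar> \<le> 2 * B"
      using kernel_proj_bounded[of "X i \<omega>"] kernel_mean_bounded by linarith
  qed
  also have "\<dots> = 2 * B * real n" by simp
  finally have "real m / real n * \<bar>\<Sum>i=1..n. kernel_proj (X i \<omega>) - kernel_mean\<bar> \<le> real m / real n * (2 * B * real n)"
    by (intro mult_left_mono) auto
  also have "\<dots> \<le> 2 * B * real m" using bound_nonneg by (cases "n = 0") auto
  finally have "\<bar>real m / real n * (\<Sum>i=1..n. kernel_proj (X i \<omega>) - kernel_mean)\<bar> \<le> 2 * B * real m"
    by (simp add: abs_mult)
  then show ?thesis
    using U_stat_minus_mean_bounded[of n \<omega>] unfolding hajek_remainder_def distrib_left by linarith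
qed

text \<open>
  The second moment of the remainder is of order \<open>n\<^sup>-\<^sup>2\<close>, which beats the factor \<open>n\<close> from the scaling.
\<close>

lemma scaled_hajek_remainder_negligible:
  "tends_to_zero_in_prob (\<lambda>n \<omega>. sqrt (real n) * hajek_remainder n \<omega>)"
proof (rule tends_to_zero_in_prob_if_second_moment)
  show "integrable M (\<lambda>\<omega>. (sqrt (real n) * hajek_remainder n \<omega>)\<^sup>2)" for n
  proof (rule integrable_const_bound[of _ "real n * (2 * B * (real m + 1))\<^sup>2"])
    have "(hajek_remainder n \<omega>)\<^sup>2 \<le> (2 * B * (real m + 1))\<^sup>2" for \<omega>
      using power_mono[OF hajek_remainder_bounded abs_ge_zero, of n \<omega> 2] by (simp only: power2_abs)
    then show "AE \<omega> in M. norm ((sqrt (real n) * hajek_remainder n \<omega>)\<^sup>2) \<le> real n * (2 * B * (real m + 1))\<^sup>2"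
      by (auto simp: power_mult_distrib intro!: mult_left_mono)
  qed measurable
  define C where "C = (2 * B * (real m + 1))\<^sup>2 * (real (m choose 2))\<^sup>2"
  have lim: "(\<lambda>n. 4 * C / real n) \<longlonglongrightarrow> 0"
    by (rule lim_const_over_n)
  show "(\<lambda>n. \<integral>\<omega>. (sqrt (real n) * hajek_remainder n \<omega>)\<^sup>2 \<partial>M) \<longlonglongrightarrow> 0"
  proof (rule Lim_null_comparison[OF _ lim])
    show "\<forall>\<^sub>F n in sequentially. norm (\<integral>\<omega>. (sqrt (real n) * hajek_remainder n \<omega>)\<^sup>2 \<partial>M) \<le> 4 * C / real n"
      using eventually_ge_at_top[of "max m 2"]
    proof eventually_elim
      case (elim n)
      then have n: "0 < real n" "m \<le> n" "2 \<le> n" by auto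
      have "(real n / 2)\<^sup>2 \<le> real (n choose 2)"
        using binomial_ge_n_over_k_pow_k[OF n(3), where 'a=real] by simp
      then have "C / real (n choose 2) \<le> C / (real n / 2)\<^sup>2"
        using n by (intro divide_left_mono) (auto simp: C_def)
      then have "(\<integral>\<omega>. (hajek_remainder n \<omega>)\<^sup>2 \<partial>M) \<le> C / (real n / 2)\<^sup>2"
        using hajek_remainder_second_moment_le[OF n(2)] by (simp add: C_def)
      then have "real n * (\<integral>\<omega>. (hajek_remainder n \<omega>)\<^sup>2 \<partial>M) \<le> real n * (C / (real n / 2)\<^sup>2)"
        by (intro mult_left_mono) auto
      also have "\<dots> = 4 * C / real n" using n by (simp add: field_simps power2_eq_square)
      finally show ?case by (simp add: power_mult_distrib)
    qed
  qed
qed measurable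

end

section \<open>The central limit theorem for the projection\<close>

lemma char_normal_distribution_scale:
  assumes "0 < \<sigma>"
  shows "char (density lborel (normal_density 0 \<sigma>)) t = char std_normal_distribution (\<sigma> * t)"
proof -
  interpret N: real_distribution std_normal_distribution by (rule real_dist_normal_dist)
  have "distributed std_normal_distribution lborel (\<lambda>x. x) std_normal_density"
    by (simp add: distributed_def distr_id2)
  then have "distributed std_normal_distribution lborel (\<lambda>x. 0 + \<sigma> * x) (normal_density (0 + \<sigma> * 0) (\<bar>\<sigma>\<bar> * 1))"
    using assms by (intro N.normal_density_affine) auto
  then have "density lborel (normal_density 0 \<sigma>) = distr std_normal_distribution lborel (\<lambda>x. \<sigma> * x)"
    using assms by (simp add: distributed_def)
  then show ?thesis
    by (simp add: char_def integral_distr ac_simps)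
qed

lemma real_distribution_normal:
  "0 < \<sigma> \<Longrightarrow> real_distribution (density lborel (normal_density \<mu> \<sigma>))"
  by (simp add: real_distribution_def real_distribution_axioms_def prob_space_normal_density)

lemma (in prob_space) char_distr:
  assumes [measurable]: "V \<in> borel_measurable M"
  shows "char (distr M borel V) t = (\<integral>\<omega>. iexp (t * V \<omega>) \<partial>M)"
  unfolding char_def by (rule integral_distr) measurable

lemma (in iid_sample) indep_shifted_sample: "indep_vars (\<lambda>_. S) (\<lambda>i. X (Suc i)) UNIV"
  by (subst indep_vars_iff_distr_eq_PiM)
    (simp_all add: distr_X distr_reindexed_sample[of Suc UNIV, simplified])

context bounded_kernel begin

text \<open>
  The sum runs over \<open>X 1, \<dots>, X n\<close>, whereas \<open>central_limit_theorem_zero_mean\<close> sums from index 0, hence the shifted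
  sample. Evaluating the characteristic functions at \<open>\<sigma> t\<close> undoes the standardization.
\<close>

lemma projection_clt:
  defines "\<sigma>2 \<equiv> (\<integral>\<omega>. (kernel_proj (X 0 \<omega>) - kernel_mean)\<^sup>2 \<partial>M)"
  assumes pos: "0 < \<sigma>2"
  shows "(\<lambda>n. char (distr M borel (\<lambda>\<omega>. (\<Sum>i=1..n. kernel_proj (X i \<omega>) - kernel_mean) / sqrt (real n))) t)
    \<longlonglongrightarrow> char (density lborel (normal_density 0 (sqrt \<sigma>2))) t"
proof -
  define g where "g x = kernel_proj x - kernel_mean" for x
  have [measurable]: "g \<in> borel_measurable S" unfolding g_def[abs_def] by measurable
  have g_bound: "\<bar>g x\<bar> \<le> 2 * B" for x
    unfolding g_def using kernel_proj_bounded[of x] kernel_mean_bounded by linarith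
  let ?Y = "\<lambda>i \<omega>. g (X (Suc i) \<omega>)" and ?s = "sqrt \<sigma>2"
  have mean: "expectation (?Y i) = 0" for i
    unfolding g_def by (simp add: integrable_kernel_proj expectation_kernel_proj prob_space)
  have indep': "indep_vars (\<lambda>_. borel) ?Y UNIV"
    by (rule indep_vars_compose2[OF indep_shifted_sample]) simp
  have sq: "integrable M (\<lambda>\<omega>. (?Y i \<omega>)\<^sup>2)" for i
  proof (rule integrable_const_bound[of _ "(2 * B)\<^sup>2"])
    have "(g x)\<^sup>2 \<le> (2 * B)\<^sup>2" for x
      using power_mono[OF g_bound abs_ge_zero, of x 2] by (simp only: power2_abs)
    then show "AE \<omega> in M. norm ((?Y i \<omega>)\<^sup>2) \<le> (2 * B)\<^sup>2" by simp
  qed measurable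
  have law: "distr M borel (\<lambda>\<omega>. f (X i \<omega>)) = distr F borel f"
    if [measurable]: "f \<in> borel_measurable S" for f :: "'a \<Rightarrow> real" and i
    by (simp add: distr_X[of i, symmetric] distr_distr comp_def)
  have var: "variance (?Y i) = ?s\<^sup>2" for i
  proof -
    have "variance (?Y i) = (\<integral>\<omega>. (g (X (Suc i) \<omega>))\<^sup>2 \<partial>M)" by (simp add: mean)
    also have "\<dots> = (\<integral>x. (g x)\<^sup>2 \<partial>F)"
      by (subst distr_X[of "Suc i", symmetric], subst integral_distr) auto
    also have "\<dots> = (\<integral>\<omega>. (g (X 0 \<omega>))\<^sup>2 \<partial>M)"
      by (subst distr_X[of 0, symmetric], subst integral_distr) auto
    finally show ?thesis using pos by (simp add: \<sigma>2_def g_def)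
  qed
  have "weak_conv_m (\<lambda>n. distr M borel (\<lambda>\<omega>. (\<Sum>i<n. ?Y i \<omega>) / sqrt (real n * ?s\<^sup>2))) std_normal_distribution"
    by (rule central_limit_theorem_zero_mean[OF indep' mean _ sq var law]) (use pos in auto)
  then have lim: "(\<lambda>n. char (distr M borel (\<lambda>\<omega>. (\<Sum>i<n. ?Y i \<omega>) / sqrt (real n * ?s\<^sup>2))) (?s * t))
      \<longlonglongrightarrow> char std_normal_distribution (?s * t)"
    by (intro levy_continuity1 real_distribution_distr real_dist_normal_dist) auto
  have "char (distr M borel (\<lambda>\<omega>. (\<Sum>i<n. ?Y i \<omega>) / sqrt (real n * ?s\<^sup>2))) (?s * t)
      = char (distr M borel (\<lambda>\<omega>. (\<Sum>i=1..n. kernel_proj (X i \<omega>) - kernel_mean) / sqrt (real n))) t" for n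
  proof -
    have shift: "(\<Sum>i=1..n. kernel_proj (X i \<omega>) - kernel_mean) = (\<Sum>i<n. ?Y i \<omega>)" for \<omega>
      unfolding g_def by (rule sum.reindex_bij_witness[where i=Suc and j="\<lambda>i. i - 1"]) auto
    have "?s * t * ((\<Sum>i<n. ?Y i \<omega>) / sqrt (real n * ?s\<^sup>2)) = t * ((\<Sum>i<n. ?Y i \<omega>) / sqrt (real n))" for \<omega>
      using pos by (simp add: real_sqrt_mult)
    note eq = this
    have meas: "(\<lambda>\<omega>. (\<Sum>i<n. ?Y i \<omega>) / r) \<in> borel_measurable M" for r :: real
      by measurable
    show ?thesis
      unfolding shift char_distr[OF meas] eq ..
  qed
  from lim[unfolded this] show ?thesis
    using char_normal_distribution_scale[of ?s t] pos by (simp only: real_sqrt_gt_0_iff)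
qed

end

section \<open>Continuity points of the quantile function\<close>

text \<open>
  For \<open>t > \<gamma>\<close>, every \<open>x\<close> with \<open>H x \<le> \<gamma>\<close> lies below every \<open>y\<close> with \<open>t \<le> H y\<close>, so that \<open>xi_plus H \<gamma> \<le> quantile H t\<close>.
  Letting \<open>t\<close> decrease to \<open>\<gamma>\<close>, continuity makes the upper and the lower \<open>\<gamma>\<close>-quantile coincide.
\<close>

lemma quantile_continuity_point:
  fixes H :: "real \<Rightarrow> real"
  assumes mono: "mono H" and bot: "(H \<longlongrightarrow> 0) at_bot" and top: "(H \<longlongrightarrow> 1) at_top"
    and \<gamma>: "0 < \<gamma>" "\<gamma> < 1" and cont: "isCont (quantile H) \<gamma>"
  shows "xi_plus H \<gamma> = xi_minus H \<gamma>"
    and "x < xi_minus H \<gamma> \<Longrightarrow> H x < \<gamma>"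
    and "xi_minus H \<gamma> < x \<Longrightarrow> \<gamma> < H x"
proof -
  have upper_ne: "\<exists>y. t < H y" if "t < 1" for t
    using order_tendstoD(1)[OF top that] by (rule eventually_happens'[rotated]) simp
  have lower_ne: "\<exists>z. H z < t" if "0 < t" for t
    using order_tendstoD(2)[OF bot that] by (rule eventually_happens'[rotated]) simp
  have bdd_below: "bdd_below {y. t \<le> H y}" if t: "0 < t" for t
  proof -
    obtain z where "H z < t" using lower_ne[OF t] by blast
    then have "z \<le> y" if "t \<le> H y" for y using that monoD[OF mono, of y z] by fastforce
    then show ?thesis by (intro bdd_belowI[of _ z]) simp
  qed
  have bdd_above: "bdd_above {y. H y \<le> t}" if t: "t < 1" for t
  proof -
    obtain z where "t < H z" using upper_ne[OF t] by blast
    then have "y \<le> z" if "H y \<le> t" for y using that monoD[OF mono, of z y] by fastforce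
    then show ?thesis by (intro bdd_aboveI[of _ z]) simp
  qed
  have lt: "H x < \<gamma>" if "x < xi_minus H \<gamma>" for x
  proof (rule ccontr)
    assume "\<not> H x < \<gamma>"
    then have "xi_minus H \<gamma> \<le> x"
      unfolding xi_minus_def by (intro cInf_lower bdd_below \<gamma>) auto
    then show False using that by simp
  qed
  have gt: "\<gamma> < H x" if "xi_plus H \<gamma> < x" for x
  proof (rule ccontr)
    assume "\<not> \<gamma> < H x"
    then have "x \<le> xi_plus H \<gamma>"
      unfolding xi_plus_def by (intro cSup_upper bdd_above \<gamma>) auto
    then show False using that by simp
  qed
  have "xi_minus H \<gamma> \<le> xi_plus H \<gamma>"
  proof (rule dense_le)
    fix x assume "x < xi_minus H \<gamma>"
    then have "H x \<le> \<gamma>" using lt by fastforce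
    then show "x \<le> xi_plus H \<gamma>"
      unfolding xi_plus_def by (intro cSup_upper bdd_above \<gamma>) auto
  qed
  moreover have "xi_plus H \<gamma> \<le> xi_minus H \<gamma>"
  proof -
    have above: "xi_plus H \<gamma> \<le> quantile H t" if t: "\<gamma> < t" "t < 1" for t
      unfolding xi_plus_def quantile_def
    proof (rule cSup_least)
      show "{x. H x \<le> \<gamma>} \<noteq> {}" using lower_ne[OF \<gamma>(1)] by (auto intro: less_imp_le)
      fix x assume x: "x \<in> {x. H x \<le> \<gamma>}"
      show "x \<le> Inf {y. t \<le> H y}"
      proof (rule cInf_greatest)
        show "{y. t \<le> H y} \<noteq> {}" using upper_ne[OF t(2)] by (auto intro: less_imp_le)
        fix y assume "y \<in> {y. t \<le> H y}"
        then show "x \<le> y" using x t monoD[OF mono, of y x] by fastforce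
      qed
    qed
    have "(quantile H \<longlongrightarrow> quantile H \<gamma>) (at_right \<gamma>)"
      using cont by (simp add: isCont_def filterlim_at_split)
    moreover have "\<forall>\<^sub>F t in at_right \<gamma>. xi_plus H \<gamma> \<le> quantile H t"
      unfolding eventually_at_right_field using above \<gamma> by blast
    ultimately have "xi_plus H \<gamma> \<le> quantile H \<gamma>"
      by (intro tendsto_lowerbound) auto
    then show ?thesis by (simp add: quantile_def xi_minus_def)
  qed
  ultimately show "xi_plus H \<gamma> = xi_minus H \<gamma>" by simp
  then show "xi_minus H \<gamma> < x \<Longrightarrow> \<gamma> < H x" using gt by simp
  show "x < xi_minus H \<gamma> \<Longrightarrow> H x < \<gamma>" by (rule lt)
qed

section \<open>Order statistics and trimming indices\<close>

lemma ordered_values_sorted: "sorted (ordered_values m h x n)"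
  by (simp add: ordered_values_def)

lemma sum_list_ordered_values:
  "(\<Sum>y\<leftarrow>ordered_values m h x n. f y) = (\<Sum>I\<in>index_sets n m. f (kernel_value m h x I) :: real)"
proof -
  have "(\<Sum>y\<leftarrow>ordered_values m h x n. f y) = (\<Sum>y\<in>#mset (ordered_values m h x n). f y)"
    by (simp flip: sum_mset_sum_list)
  then show ?thesis
    by (simp add: ordered_values_def sum_unfold_sum_mset image_mset.compositionality comp_def)
qed

lemma length_filter_eq_sum_list: "real (length (filter P xs)) = (\<Sum>y\<leftarrow>xs. of_bool (P y))"
  by (induction xs) auto

lemma length_ordered_values: "length (ordered_values m h x n) = n choose m"
proof -
  have "real (length (ordered_values m h x n)) = (\<Sum>I\<in>index_sets n m. 1)"
    using length_filter_eq_sum_list[of "\<lambda>_. True" "ordered_values m h x n"]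
    by (simp add: sum_list_ordered_values)
  then show ?thesis using card_index_sets[of n m] by simp
qed

lemma trim_index_le: "\<gamma> \<le> 1 \<Longrightarrow> trim_index m n \<gamma> \<le> n choose m"
proof -
  assume "\<gamma> \<le> 1"
  then have "\<gamma> * real (n choose m) \<le> real (n choose m)" using mult_right_mono[OF \<open>\<gamma> \<le> 1\<close>, of "real (n choose m)"] by simp
  then have "\<lfloor>\<gamma> * real (n choose m)\<rfloor> \<le> \<lfloor>real (n choose m)\<rfloor>" by (rule floor_mono)
  then show ?thesis by (simp add: trim_index_def nat_le_iff)
qed

lemma trim_index_bounds:
  assumes "0 \<le> \<gamma>"
  shows "real (trim_index m n \<gamma>) \<le> \<gamma> * real (n choose m)"
    and "\<gamma> * real (n choose m) - 1 < real (trim_index m n \<gamma>)"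
proof -
  have "0 \<le> \<lfloor>\<gamma> * real (n choose m)\<rfloor>" using assms by simp
  then have "real (trim_index m n \<gamma>) = of_int \<lfloor>\<gamma> * real (n choose m)\<rfloor>"
    by (simp add: trim_index_def)
  then show "real (trim_index m n \<gamma>) \<le> \<gamma> * real (n choose m)"
    and "\<gamma> * real (n choose m) - 1 < real (trim_index m n \<gamma>)" by linarith+
qed

lemma trimmed_U_eq_diff:
  assumes "\<alpha> \<le> \<beta>"
  shows "trimmed_U m h \<alpha> \<beta> n x =
    ((\<Sum>i<trim_index m n \<beta>. ordered_values m h x n ! i) - (\<Sum>i<trim_index m n \<alpha>. ordered_values m h x n ! i)) /
    (real (trim_index m n \<beta>) - real (trim_index m n \<alpha>))"
proof -
  let ?k = "trim_index m n" and ?v = "\<lambda>i. ordered_values m h x n ! i"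
  have le: "?k \<alpha> \<le> ?k \<beta>"
    using assms by (auto simp: trim_index_def intro!: nat_mono floor_mono mult_right_mono)
  have "(\<Sum>i = ?k \<alpha> + 1..?k \<beta>. ?v (i - 1)) = (\<Sum>i = ?k \<alpha>..<?k \<beta>. ?v i)"
    by (rule sum.reindex_bij_witness[where i=Suc and j="\<lambda>i. i - 1"]) auto
  also have "\<dots> = (\<Sum>i<?k \<beta>. ?v i) - (\<Sum>i<?k \<alpha>. ?v i)"
    using sum_diff_nat_ivl[of 0 "?k \<alpha>" "?k \<beta>" ?v] le by (simp add: atLeast0LessThan)
  finally show ?thesis by (simp add: trimmed_U_def)
qed

lemma binomial_at_least_ratio:
  assumes "1 \<le> m" "m \<le> n"
  shows "real n / real m \<le> real (n choose m)"
proof -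
  have "1 \<le> real n / real m" using assms by simp
  then have "real n / real m \<le> (real n / real m) ^ m" using assms by (intro self_le_power) auto
  also have "\<dots> \<le> real (n choose m)" by (rule binomial_ge_n_over_k_pow_k[OF assms(2)])
  finally show ?thesis .
qed

text \<open>
  Rounding errors are of order \<open>1 / N\<close> with \<open>N = n choose m\<close>. This is what makes them negligible at scale \<open>\<surd>n\<close>.
\<close>

lemma sqrt_over_binomial_tendsto_0:
  assumes "1 \<le> m"
  shows "(\<lambda>n. sqrt (real n) / real (n choose m)) \<longlonglongrightarrow> 0"
proof (rule Lim_null_comparison)
  have "(\<lambda>n. real m * inverse (sqrt (real n))) \<longlonglongrightarrow> real m * 0"
    by (intro tendsto_intros tendsto_inverse_0_at_top filterlim_compose[OF sqrt_at_top filterlim_real_sequentially])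
  then show "(\<lambda>n. real m / sqrt (real n)) \<longlonglongrightarrow> 0" by (simp add: divide_inverse)
  show "\<forall>\<^sub>F n in sequentially. norm (sqrt (real n) / real (n choose m)) \<le> real m / sqrt (real n)"
    using eventually_ge_at_top[of m]
  proof eventually_elim
    case (elim n)
    have n: "0 < real n" "0 < real m" "0 < real (n choose m)" using elim assms by auto
    have "sqrt (real n) / real (n choose m) \<le> sqrt (real n) / (real n / real m)"
      using binomial_at_least_ratio[OF assms elim] n by (intro divide_left_mono) auto
    also have "\<dots> = real m / sqrt (real n)"
      using n by (simp add: field_simps)
    finally show ?case using n by simp
  qed
qed

lemma binomial_at_top:
  assumes "1 \<le> m"
  shows "filterlim (\<lambda>n. real (n choose m)) at_top sequentially"
proof (rule filterlim_at_top_mono)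
  show "filterlim (\<lambda>n. inverse (real m) * real n) at_top sequentially"
    using assms by (intro filterlim_tendsto_pos_mult_at_top[OF tendsto_const] filterlim_real_sequentially) auto
  show "\<forall>\<^sub>F n in sequentially. inverse (real m) * real n \<le> real (n choose m)"
    by (rule eventually_mono[OF eventually_ge_at_top[of m]])
      (use binomial_at_least_ratio[OF assms] in \<open>simp add: field_simps\<close>)
qed

section \<open>The trimmed sum is almost linear\<close>

locale symmetric_kernel_sample = iid_sample M S F X
  for M :: "'b measure" and S F :: "'a measure" and X :: "nat \<Rightarrow> 'b \<Rightarrow> 'a" +
  fixes m :: nat and h :: "(nat \<Rightarrow> 'a) \<Rightarrow> real"
  assumes m_pos: "1 \<le> m"
    and h_measurable [measurable]: "h \<in> borel_measurable (\<Pi>\<^sub>M j\<in>{1..m}. S)"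
    and h_symmetric: "symmetric_kernel S m h"
begin

abbreviation sample_value :: "'b \<Rightarrow> nat set \<Rightarrow> real" where
  "sample_value \<omega> I \<equiv> kernel_value m h (\<lambda>i. X i \<omega>) I"

abbreviation order_stat :: "nat \<Rightarrow> 'b \<Rightarrow> nat \<Rightarrow> real" where
  "order_stat n \<omega> i \<equiv> ordered_values m h (\<lambda>i. X i \<omega>) n ! i"

abbreviation H :: "real \<Rightarrow> real" where
  "H \<equiv> kernel_cdf M X m h"

definition kernel_prob :: "real set \<Rightarrow> real" where
  "kernel_prob A = prob {\<omega> \<in> space M. h (\<lambda>j\<in>{1..m}. X j \<omega>) \<in> A}"

definition empirical_prob :: "real set \<Rightarrow> nat \<Rightarrow> 'b \<Rightarrow> real" where
  "empirical_prob A n \<omega> = (\<Sum>I\<in>index_sets n m. indicat_real A (sample_value \<omega> I)) / real (n choose m)"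

lemma h_sample_measurable [measurable]: "(\<lambda>\<omega>. h (\<lambda>j\<in>{1..m}. X j \<omega>)) \<in> borel_measurable M"
  by (rule measurable_compose[OF restrict_X_measurable h_measurable])

text \<open>
  Truncated linear functions and indicators of \<open>h\<close> are bounded kernels, although \<open>h\<close> itself may have no moments.
\<close>

lemma bounded_transform:
  assumes "f \<in> borel_measurable borel" "\<And>y. \<bar>f y\<bar> \<le> B"
  shows "bounded_kernel M S F X m (\<lambda>x. f (h x)) B"
proof unfold_locales
  show "(\<lambda>x. f (h x)) \<in> borel_measurable (\<Pi>\<^sub>M j\<in>{1..m}. S)"
    by (rule measurable_compose[OF h_measurable assms(1)])
  show "symmetric_kernel S m (\<lambda>x. f (h x))"
    using h_symmetric by (simp add: symmetric_kernel_def)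
qed (use m_pos assms(2) in auto)

lemma H_eq_kernel_prob: "H x = kernel_prob {..x}"
  unfolding kernel_cdf_def cdf_def kernel_prob_def by (subst measure_distr[OF h_sample_measurable]) (auto intro: arg_cong[where f=prob])

lemma real_distribution_H: "real_distribution (distr M borel (\<lambda>\<omega>. h (\<lambda>j\<in>{1..m}. X j \<omega>)))"
  by (rule real_distribution_distr) measurable

lemma mono_H: "mono H"
proof -
  interpret D: real_distribution "distr M borel (\<lambda>\<omega>. h (\<lambda>j\<in>{1..m}. X j \<omega>))" by (rule real_distribution_H)
  show ?thesis unfolding kernel_cdf_def by (intro monoI D.cdf_nondecreasing)
qed

lemma H_at_bot: "(H \<longlongrightarrow> 0) at_bot" and H_at_top: "(H \<longlongrightarrow> 1) at_top"
proof -
  interpret D: real_distribution "distr M borel (\<lambda>\<omega>. h (\<lambda>j\<in>{1..m}. X j \<omega>))" by (rule real_distribution_H)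
  show "(H \<longlongrightarrow> 0) at_bot" "(H \<longlongrightarrow> 1) at_top"
    unfolding kernel_cdf_def by (rule D.cdf_lim_at_bot D.cdf_lim_at_top_prob)+
qed

lemma H_right_limit_ge:
  assumes "\<And>x. q < x \<Longrightarrow> \<gamma> < H x"
  shows "\<gamma> \<le> H q"
proof -
  interpret D: real_distribution "distr M borel (\<lambda>\<omega>. h (\<lambda>j\<in>{1..m}. X j \<omega>))" by (rule real_distribution_H)
  have "(H \<longlongrightarrow> H q) (at_right q)"
    using D.cdf_is_right_cont[of q] by (simp add: kernel_cdf_def continuous_within)
  moreover have "\<forall>\<^sub>F x in at_right q. \<gamma> \<le> H x"
    unfolding eventually_at_right_field using assms by (intro exI[of _ "q + 1"]) (auto intro: less_imp_le)
  ultimately show ?thesis by (intro tendsto_lowerbound) auto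
qed

lemma kernel_prob_below_le:
  assumes "\<And>x. x < q \<Longrightarrow> H x < \<gamma>"
  shows "kernel_prob {..<q} \<le> \<gamma>"
proof -
  interpret D: real_distribution "distr M borel (\<lambda>\<omega>. h (\<lambda>j\<in>{1..m}. X j \<omega>))" by (rule real_distribution_H)
  have "kernel_prob {..<q} = measure (distr M borel (\<lambda>\<omega>. h (\<lambda>j\<in>{1..m}. X j \<omega>))) {..<q}"
    unfolding kernel_prob_def by (subst measure_distr[OF h_sample_measurable]) (auto intro: arg_cong[where f=prob])
  then have "(H \<longlongrightarrow> kernel_prob {..<q}) (at_left q)"
    using D.cdf_at_left[of q] by (simp add: kernel_cdf_def)
  moreover have "\<forall>\<^sub>F x in at_left q. H x \<le> \<gamma>"
    unfolding eventually_at_left_field using assms by (intro exI[of _ "q - 1"]) (auto intro: less_imp_le)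
  ultimately show ?thesis by (intro tendsto_upperbound) auto
qed

lemma
  assumes A: "A \<in> sets borel"
  shows empirical_prob_measurable: "empirical_prob A n \<in> borel_measurable M"
    and empirical_prob_consistent: "tends_to_zero_in_prob (\<lambda>n \<omega>. empirical_prob A n \<omega> - kernel_prob A)"
    and integrable_scaled_emp_power2: "integrable M (\<lambda>\<omega>. (c * (empirical_prob A n \<omega> - kernel_prob A))\<^sup>2)"
    and scaled_emp_second_moment_le: "m \<le> n \<Longrightarrow>
      (\<integral>\<omega>. (sqrt (real n) * (empirical_prob A n \<omega> - kernel_prob A))\<^sup>2 \<partial>M) \<le> 4 * (real m)\<^sup>2"
proof -
  interpret K: bounded_kernel M S F X m "\<lambda>x. indicat_real A (h x)" 1
    by (rule bounded_transform) (use A in auto)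
  have emp: "empirical_prob A = K.U_stat"
    by (simp add: fun_eq_iff empirical_prob_def K.U_stat_def kernel_value_def)
  have "K.kernel_mean = (\<integral>\<omega>. indicat_real {\<omega> \<in> space M. h (\<lambda>j\<in>{1..m}. X j \<omega>) \<in> A} \<omega> \<partial>M)"
    unfolding K.kernel_mean_def by (intro Bochner_Integration.integral_cong) (auto simp: indicator_def)
  also have "\<dots> = kernel_prob A" by (simp add: kernel_prob_def) (auto intro: arg_cong[where f=prob])
  finally have law: "kernel_prob A = K.kernel_mean" by simp
  show "empirical_prob A n \<in> borel_measurable M"
    "tends_to_zero_in_prob (\<lambda>n \<omega>. empirical_prob A n \<omega> - kernel_prob A)"
    "integrable M (\<lambda>\<omega>. (c * (empirical_prob A n \<omega> - kernel_prob A))\<^sup>2)"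
    "m \<le> n \<Longrightarrow> (\<integral>\<omega>. (sqrt (real n) * (empirical_prob A n \<omega> - kernel_prob A))\<^sup>2 \<partial>M) \<le> 4 * (real m)\<^sup>2"
    unfolding emp law
    using K.U_stat_measurable K.U_stat_consistent K.integrable_scaled_U_stat_power2
      K.scaled_U_stat_second_moment_le[of n] by simp_all
qed

text \<open>
  The counts that govern the order statistics are U-statistics with an indicator kernel.
\<close>

lemma length_filter_ordered_values:
  "real (length (filter (\<lambda>y. y \<in> A) (ordered_values m h (\<lambda>i. X i \<omega>) n))) = real (n choose m) * empirical_prob A n \<omega>"
proof (cases "m \<le> n")
  case True
  then have "real (n choose m) \<noteq> 0" by simp
  then show ?thesis
    by (simp add: length_filter_eq_sum_list sum_list_ordered_values empirical_prob_def indicator_def of_bool_def)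
next
  case False
  then have "ordered_values m h (\<lambda>i. X i \<omega>) n = []"
    by (metis not_le binomial_eq_0 length_0_conv length_ordered_values)
  then show ?thesis using False by (simp add: binomial_eq_0)
qed

lemma order_stat_le_iff:
  assumes "i < n choose m"
  shows "order_stat n \<omega> i \<le> y \<longleftrightarrow> real i < real (n choose m) * empirical_prob {..y} n \<omega>"
  using nth_iff_less_length_filter[OF ordered_values_sorted,
      of i m h "\<lambda>i. X i \<omega>" n "\<lambda>v. v \<le> y"] assms
    length_filter_ordered_values[of "{..y}" \<omega> n, symmetric]
  by (simp add: length_ordered_values)

lemma order_stat_measurable:
  assumes "i < n choose m \<or> n choose m = 0"
  shows "(\<lambda>\<omega>. order_stat n \<omega> i) \<in> borel_measurable M"
proof (cases "n choose m = 0")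
  case True
  then have "ordered_values m h (\<lambda>i. X i \<omega>) n = []" for \<omega>
    by (metis not_le binomial_eq_0 length_0_conv length_ordered_values)
  then show ?thesis by simp
next
  case False
  note empirical_prob_measurable[of "{.._::real}", measurable]
  show ?thesis
    unfolding borel_measurable_iff_le using False assms
    by (auto simp: order_stat_le_iff)
qed

text \<open>
  If the order statistic exceeds \<open>q + \<epsilon>\<close>, then the empirical distribution function at \<open>q + \<epsilon>\<close> is below
  \<open>\<gamma> < H (q + \<epsilon>)\<close>; if it lies below \<open>q - \<epsilon>\<close>, then the empirical distribution function at \<open>q - \<epsilon>\<close> is, up to
  rounding, at least \<open>\<gamma> > H (q - \<epsilon>)\<close>. Both are excluded in the limit by the weak law for U-statistics.
  The index is shifted because lists start at 0.
\<close>

lemma order_stat_consistent: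
  assumes \<gamma>: "0 < \<gamma>" "\<gamma> < 1"
    and below: "\<And>x. x < q \<Longrightarrow> H x < \<gamma>" and above: "\<And>x. q < x \<Longrightarrow> \<gamma> < H x"
  shows "tends_to_zero_in_prob (\<lambda>n \<omega>. order_stat n \<omega> (trim_index m n \<gamma> - 1) - q)"
  unfolding tends_to_zero_in_prob_def
proof (intro allI impI)
  fix \<epsilon> :: real assume \<epsilon>: "0 < \<epsilon>"
  define \<delta>1 where "\<delta>1 = (H (q + \<epsilon>) - \<gamma>) / 2"
  define \<delta>2 where "\<delta>2 = (\<gamma> - H (q - \<epsilon>)) / 2"
  have \<delta>: "0 < \<delta>1" "0 < \<delta>2" using above[of "q + \<epsilon>"] below[of "q - \<epsilon>"] \<epsilon> by (auto simp: \<delta>1_def \<delta>2_def)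
  note empirical_prob_measurable[of "{.._::real}", measurable]
  let ?E1 = "\<lambda>n. {\<omega> \<in> space M. \<delta>1 < \<bar>empirical_prob {..q + \<epsilon>} n \<omega> - kernel_prob {..q + \<epsilon>}\<bar>}"
  let ?E2 = "\<lambda>n. {\<omega> \<in> space M. \<delta>2 < \<bar>empirical_prob {..q - \<epsilon>} n \<omega> - kernel_prob {..q - \<epsilon>}\<bar>}"
  have "(\<lambda>n. prob (?E1 n) + prob (?E2 n)) \<longlonglongrightarrow> 0 + 0"
    using empirical_prob_consistent[of "{.._::real}"] \<delta> unfolding tends_to_zero_in_prob_def
    by (intro tendsto_add) auto
  then have lim: "(\<lambda>n. prob (?E1 n) + prob (?E2 n)) \<longlonglongrightarrow> 0" by simp
  \<comment> \<open>the first bound makes the order statistic exist, the second one absorbs the index shift and the rounding\<close>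
  have ev: "\<forall>\<^sub>F n in sequentially. max (1 / \<gamma>) (2 / \<delta>2) \<le> real (n choose m)"
    using binomial_at_top[OF m_pos] unfolding filterlim_at_top by blast
  show "(\<lambda>n. prob {\<omega> \<in> space M. \<epsilon> < \<bar>order_stat n \<omega> (trim_index m n \<gamma> - 1) - q\<bar>}) \<longlonglongrightarrow> 0"
  proof (rule Lim_null_comparison[OF _ lim])
    show "\<forall>\<^sub>F n in sequentially. norm (prob {\<omega> \<in> space M. \<epsilon> < \<bar>order_stat n \<omega> (trim_index m n \<gamma> - 1) - q\<bar>})
        \<le> prob (?E1 n) + prob (?E2 n)"
      using ev
    proof eventually_elim
      case (elim n)
      define N where "N = real (n choose m)"
      define k where "k = trim_index m n \<gamma>"
      have N: "1 \<le> \<gamma> * N" "2 \<le> \<delta>2 * N"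
        using elim \<gamma> \<delta> by (simp_all add: N_def field_simps)
      then have N0: "0 < N" using \<gamma> by (smt (verit) mult_nonneg_nonpos)
      have k: "real k \<le> \<gamma> * N" "\<gamma> * N - 1 < real k" "k \<le> n choose m"
        using trim_index_bounds[where \<gamma>=\<gamma> and m=m and n=n] trim_index_le[of \<gamma> m n] \<gamma> by (simp_all add: N_def k_def)
      then have "1 \<le> k" using N by (cases k) auto
      then have k1: "k - 1 < n choose m" "real (k - 1) = real k - 1" using k by auto
      note iff = order_stat_le_iff[OF k1(1), folded N_def, unfolded k1(2)]
      have "{\<omega> \<in> space M. \<epsilon> < \<bar>order_stat n \<omega> (k - 1) - q\<bar>} \<subseteq> ?E1 n \<union> ?E2 n"
      proof
        fix \<omega> assume \<omega>: "\<omega> \<in> {\<omega> \<in> space M. \<epsilon> < \<bar>order_stat n \<omega> (k - 1) - q\<bar>}"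
        then consider "\<not> order_stat n \<omega> (k - 1) \<le> q + \<epsilon>" | "order_stat n \<omega> (k - 1) \<le> q - \<epsilon>"
          by fastforce
        then show "\<omega> \<in> ?E1 n \<union> ?E2 n"
        proof cases
          case 1
          then have "N * empirical_prob {..q + \<epsilon>} n \<omega> \<le> real k - 1" using iff by fastforce
          then have "N * empirical_prob {..q + \<epsilon>} n \<omega> < N * \<gamma>" using k by (simp add: mult.commute)
          then have "empirical_prob {..q + \<epsilon>} n \<omega> < \<gamma>" using N0 by simp
          then show ?thesis using \<omega> \<delta> by (auto simp: \<delta>1_def H_eq_kernel_prob)
        next
          case 2
          then have "real k - 1 < N * empirical_prob {..q - \<epsilon>} n \<omega>" using iff by fastforce
          then have "N * (\<gamma> - \<delta>2) < N * empirical_prob {..q - \<epsilon>} n \<omega>" using k N by (simp add: algebra_simps)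
          then have "\<gamma> - \<delta>2 < empirical_prob {..q - \<epsilon>} n \<omega>" using N0 by simp
          then show ?thesis using \<omega> \<delta> by (auto simp: \<delta>2_def H_eq_kernel_prob field_simps)
        qed
      qed
      then have "prob {\<omega> \<in> space M. \<epsilon> < \<bar>order_stat n \<omega> (k - 1) - q\<bar>} \<le> prob (?E1 n \<union> ?E2 n)"
        by (intro finite_measure_mono) measurable
      also have "\<dots> \<le> prob (?E1 n) + prob (?E2 n)"
        by (rule measure_Un_le) measurable
      finally show ?case by (simp add: k_def)
    qed
  qed
qed

text \<open>
  The error in replacing the sum of the smallest values by \<open>N (\<gamma> q)\<close> plus a sum of truncated linear functions of the
  individual kernel values, relative to \<open>N = n choose m\<close>.
\<close>

definition linearization_error :: "real \<Rightarrow> real \<Rightarrow> nat \<Rightarrow> 'b \<Rightarrow> real" where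
  "linearization_error \<gamma> q n \<omega> =
     (\<Sum>i<trim_index m n \<gamma>. order_stat n \<omega> i) / real (n choose m)
     - (\<gamma> * q + (\<Sum>I\<in>index_sets n m. min (sample_value \<omega> I - q) 0) / real (n choose m))"

lemma partial_sum_measurable:
  assumes "\<gamma> \<le> 1"
  shows "(\<lambda>\<omega>. \<Sum>i<trim_index m n \<gamma>. order_stat n \<omega> i) \<in> borel_measurable M"
  using trim_index_le[OF assms, of m n] by (intro borel_measurable_sum order_stat_measurable) auto

lemma linearization_error_measurable:
  assumes "\<gamma> \<le> 1"
  shows "linearization_error \<gamma> q n \<in> borel_measurable M"
proof -
  have [measurable]: "(\<lambda>\<omega>. sample_value \<omega> I) \<in> borel_measurable M" if "I \<in> index_sets n m" for I
    by (rule kernel_value_sample_measurable[OF h_measurable index_setsD(1,2)[OF that]])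
  note partial_sum_measurable[OF assms, measurable]
  show ?thesis unfolding linearization_error_def[abs_def] by measurable
qed

text \<open>
  By \<open>partial_sum_sorted_approx\<close>, the scaled error is at most \<open>\<bar>order_stat - q\<bar>\<close>, which tends to zero in probability,
  times a scaled deviation of empirical from true probabilities, which is bounded in \<open>L\<^sup>2\<close>. The events
  \<open>h \<le> q\<close> and \<open>h < q\<close> are treated apart: \<open>\<gamma> \<le> P(h \<le> q)\<close> bounds the excess of \<open>k\<close> over the first
  count, and \<open>P(h < q) \<le> \<gamma>\<close> bounds the excess of the second count over \<open>k\<close>.
\<close>

lemma linearization_error_negligible:
  assumes \<gamma>: "0 < \<gamma>" "\<gamma> < 1"
    and below: "\<And>x. x < q \<Longrightarrow> H x < \<gamma>" and above: "\<And>x. q < x \<Longrightarrow> \<gamma> < H x"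
  shows "tends_to_zero_in_prob (\<lambda>n \<omega>. sqrt (real n) * linearization_error \<gamma> q n \<omega>)"
proof -
  define Z where "Z n \<omega> = \<bar>order_stat n \<omega> (trim_index m n \<gamma> - 1) - q\<bar>" for n \<omega>
  define W where "W A n \<omega> = sqrt (real n) * (empirical_prob A n \<omega> - kernel_prob A)" for A n \<omega>
  define c where "c n = sqrt (real n) / real (n choose m)" for n
  have Z_lim: "tends_to_zero_in_prob Z"
    using order_stat_consistent[OF assms] by (simp add: tends_to_zero_in_prob_def Z_def)
  have Z_meas [measurable]: "Z n \<in> borel_measurable M" for n
  proof -
    have "trim_index m n \<gamma> - 1 < n choose m \<or> n choose m = 0"
      using trim_index_le[of \<gamma> m n] \<gamma> by linarith
    from order_stat_measurable[OF this] show ?thesis unfolding Z_def[abs_def] by measurable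
  qed
  have ZW: "tends_to_zero_in_prob (\<lambda>n \<omega>. Z n \<omega> * W A n \<omega>)" and W_meas: "W A n \<in> borel_measurable M"
    if A: "A \<in> sets borel" for A n
  proof -
    note empirical_prob_measurable[OF A, measurable]
    show meas: "W A n \<in> borel_measurable M" for n unfolding W_def[abs_def] by measurable
    show "tends_to_zero_in_prob (\<lambda>n \<omega>. Z n \<omega> * W A n \<omega>)"
    proof (rule tends_to_zero_in_prob_mult_bounded[OF Z_lim Z_meas meas])
      show "integrable M (\<lambda>\<omega>. (W A n \<omega>)\<^sup>2)" for n
        unfolding W_def by (rule integrable_scaled_emp_power2[OF A])
      show "\<forall>\<^sub>F n in sequentially. (\<integral>\<omega>. (W A n \<omega>)\<^sup>2 \<partial>M) \<le> 4 * (real m)\<^sup>2"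
        unfolding W_def by (rule eventually_mono[OF eventually_ge_at_top[of m]])
          (rule scaled_emp_second_moment_le[OF A])
    qed
  qed
  note ZW1 = ZW[of "{..q}"] and ZW2 = ZW[of "{..<q}"]
  note [measurable] = W_meas[of "{..q}"] W_meas[of "{..<q}"]
  have c_lim: "c \<longlonglongrightarrow> 0"
    unfolding c_def using sqrt_over_binomial_tendsto_0[OF m_pos] .
  have Zc: "tends_to_zero_in_prob (\<lambda>n \<omega>. Z n \<omega> * c n)"
  proof (rule tends_to_zero_in_prob_dominated[OF Z_lim Z_meas])
    have "\<forall>\<^sub>F n in sequentially. \<bar>c n\<bar> < 1"
      using c_lim by (auto simp: tendsto_iff dist_real_def)
    then show "\<forall>\<^sub>F n in sequentially. \<forall>\<omega>\<in>space M. \<bar>Z n \<omega> * c n\<bar> \<le> \<bar>Z n \<omega>\<bar>"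
      by eventually_elim (auto simp: abs_mult mult_left_le)
  qed
  have qc: "tends_to_zero_in_prob (\<lambda>n _. \<bar>q\<bar> * c n)"
    by (rule tends_to_zero_in_prob_const) (use tendsto_mult_right_zero[OF c_lim] in simp)
  have abs: "tends_to_zero_in_prob (\<lambda>n \<omega>. \<bar>V n \<omega>\<bar>)" if "tends_to_zero_in_prob V" for V
    using that by (simp add: tends_to_zero_in_prob_def)
  have "tends_to_zero_in_prob (\<lambda>n \<omega>. (\<bar>Z n \<omega> * W {..q} n \<omega>\<bar> + \<bar>Z n \<omega> * W {..<q} n \<omega>\<bar>) + (Z n \<omega> * c n + \<bar>q\<bar> * c n))"
    by (intro tends_to_zero_in_prob_add abs ZW1 ZW2 Zc qc) simp_all
  then show ?thesis
  proof (rule tends_to_zero_in_prob_dominated)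
    have "\<forall>\<^sub>F n in sequentially. 1 / \<gamma> \<le> real (n choose m)"
      using binomial_at_top[OF m_pos] unfolding filterlim_at_top by blast
    then show "\<forall>\<^sub>F n in sequentially. \<forall>\<omega>\<in>space M. \<bar>sqrt (real n) * linearization_error \<gamma> q n \<omega>\<bar>
      \<le> \<bar>(\<bar>Z n \<omega> * W {..q} n \<omega>\<bar> + \<bar>Z n \<omega> * W {..<q} n \<omega>\<bar>) + (Z n \<omega> * c n + \<bar>q\<bar> * c n)\<bar>"
    proof eventually_elim
      case (elim n)
      define N where "N = real (n choose m)"
      define k where "k = trim_index m n \<gamma>"
      have N: "1 \<le> \<gamma> * N" using elim \<gamma> by (simp add: N_def field_simps)
      then have N0: "0 < N" using \<gamma> by (smt (verit) mult_nonneg_nonpos)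
      have k: "real k \<le> \<gamma> * N" "\<gamma> * N - 1 < real k" "k \<le> n choose m"
        using trim_index_bounds[where \<gamma>=\<gamma> and m=m and n=n] trim_index_le[of \<gamma> m n] \<gamma> by (simp_all add: N_def k_def)
      then have k1: "1 \<le> k" using N by (cases k) auto
      show ?case
      proof
        fix \<omega>
        define xs where "xs = ordered_values m h (\<lambda>i. X i \<omega>) n"
        define K where "K = length (filter (\<lambda>x. x \<le> q) xs)"
        define K' where "K' = length (filter (\<lambda>x. x < q) xs)"
        have K: "real K = N * empirical_prob {..q} n \<omega>" "real K' = N * empirical_prob {..<q} n \<omega>"
          using length_filter_ordered_values[of "{..q}" \<omega> n] length_filter_ordered_values[of "{..<q}" \<omega> n]
          by (simp_all add: K_def K'_def xs_def N_def)
        let ?e1 = "\<bar>empirical_prob {..q} n \<omega> - kernel_prob {..q}\<bar>" and ?e2 = "\<bar>empirical_prob {..<q} n \<omega> - kernel_prob {..<q}\<bar>"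
        have "N * \<gamma> \<le> N * kernel_prob {..q}" "N * kernel_prob {..<q} \<le> N * \<gamma>"
          using N0 H_right_limit_ge[OF above] kernel_prob_below_le[OF below] by (auto simp: H_eq_kernel_prob)
        \<comment> \<open>\<open>k - K\<close> and \<open>K' - k\<close> are bounded by deviations since \<open>k\<close> is between \<open>N * \<gamma> - 1\<close> and \<open>N * \<gamma>\<close>\<close>
        moreover have "N * (kernel_prob {..q} - empirical_prob {..q} n \<omega>) \<le> N * ?e1" "N * (empirical_prob {..<q} n \<omega> - kernel_prob {..<q}) \<le> N * ?e2"
          using N0 by (intro mult_left_mono; simp)+
        moreover have "0 \<le> N * ?e1" "0 \<le> N * ?e2" using N0 by simp_all
        ultimately have diffs: "real (k - K) \<le> N * ?e1" "real (K' - k) \<le> N * ?e2 + 1"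
          using k K by (auto simp: of_nat_diff_real algebra_simps of_nat_diff split: nat_diff_split)
        let ?D = "(\<Sum>i<k. xs ! i) - real k * q - (\<Sum>x\<leftarrow>xs. min (x - q) 0)"
        have "\<bar>?D\<bar> \<le> \<bar>xs ! (k - 1) - q\<bar> * (real (k - K) + real (K' - k))"
          using partial_sum_sorted_approx[of xs k q] k1 k
          by (simp add: xs_def ordered_values_sorted length_ordered_values K_def K'_def)
        also have "\<dots> \<le> Z n \<omega> * (N * ?e1 + (N * ?e2 + 1))"
          using diffs by (intro mult_mono add_mono) (auto simp: Z_def xs_def k_def)
        finally have D: "\<bar>?D\<bar> \<le> Z n \<omega> * (N * ?e1 + (N * ?e2 + 1))" .
        have "linearization_error \<gamma> q n \<omega> = (?D + (real k - \<gamma> * N) * q) / N"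
          using N0 unfolding linearization_error_def sum_list_ordered_values[of "\<lambda>x. min (x - q) 0", symmetric]
          by (simp add: xs_def k_def N_def field_simps)
        then have "N * \<bar>linearization_error \<gamma> q n \<omega>\<bar> = \<bar>?D + (real k - \<gamma> * N) * q\<bar>"
          using N0 by (simp add: abs_divide)
        also have "\<dots> \<le> \<bar>?D\<bar> + \<bar>(real k - \<gamma> * N) * q\<bar>" by (rule abs_triangle_ineq)
        also have "\<bar>(real k - \<gamma> * N) * q\<bar> \<le> 1 * \<bar>q\<bar>"
          unfolding abs_mult using k by (intro mult_right_mono) auto
        finally have "N * \<bar>linearization_error \<gamma> q n \<omega>\<bar> \<le> Z n \<omega> * (N * ?e1 + (N * ?e2 + 1)) + \<bar>q\<bar>"
          using D by linarith
        then have "c n * (N * \<bar>linearization_error \<gamma> q n \<omega>\<bar>) \<le> c n * (Z n \<omega> * (N * ?e1 + (N * ?e2 + 1)) + \<bar>q\<bar>)"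
          by (rule mult_left_mono) (simp add: c_def)
        moreover have "c n * (N * \<bar>linearization_error \<gamma> q n \<omega>\<bar>) = (c n * N) * \<bar>linearization_error \<gamma> q n \<omega>\<bar>"
          by (rule mult.assoc[symmetric])
        moreover have "c n * (Z n \<omega> * (N * ?e1 + (N * ?e2 + 1)) + \<bar>q\<bar>)
          = Z n \<omega> * ((c n * N) * ?e1) + Z n \<omega> * ((c n * N) * ?e2) + Z n \<omega> * c n + \<bar>q\<bar> * c n"
          by (simp only: distrib_left mult_1_right ac_simps)
        moreover have "c n * N = sqrt (real n)" using N0 by (simp add: c_def N_def)
        ultimately have "sqrt (real n) * \<bar>linearization_error \<gamma> q n \<omega>\<bar>
          \<le> Z n \<omega> * (sqrt (real n) * ?e1) + Z n \<omega> * (sqrt (real n) * ?e2) + Z n \<omega> * c n + \<bar>q\<bar> * c n"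
          by (simp only:)
        moreover have "\<bar>Z n \<omega> * W A n \<omega>\<bar> = Z n \<omega> * (sqrt (real n) * \<bar>empirical_prob A n \<omega> - kernel_prob A\<bar>)" for A
          by (simp add: W_def abs_mult Z_def)
        ultimately show "\<bar>sqrt (real n) * linearization_error \<gamma> q n \<omega>\<bar>
          \<le> \<bar>(\<bar>Z n \<omega> * W {..q} n \<omega>\<bar> + \<bar>Z n \<omega> * W {..<q} n \<omega>\<bar>) + (Z n \<omega> * c n + \<bar>q\<bar> * c n)\<bar>"
          by (simp add: abs_mult)
      qed
    qed
  qed measurable
qed

end

section \<open>Asymptotic normality of the trimmed U-statistic\<close>

text \<open>
  As \<open>min (y - q) 0\<close> is continuous at \<open>y = q\<close>, the different treatment of \<open>y = q\<close> at the two
  levels disappears. Each level contributes the same truncated linear function as \<^term>\<open>linearization_error\<close>.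
\<close>

lemma trim_kernel_eq_min:
  "trim_kernel G \<alpha> \<beta> y = (min (y - xi_minus G \<beta>) 0 + \<beta> * xi_minus G \<beta>)
     - (min (y - xi_plus G \<alpha>) 0 + \<alpha> * xi_plus G \<alpha>)"
  by (auto simp: trim_kernel_def indicator_def)

lemma trim_kernel_bounded:
  "\<bar>trim_kernel G \<alpha> \<beta> y\<bar> \<le> \<bar>xi_minus G \<beta> - xi_plus G \<alpha>\<bar> + \<bar>\<beta> * xi_minus G \<beta>\<bar> + \<bar>\<alpha> * xi_plus G \<alpha>\<bar>"
  unfolding trim_kernel_eq_min by linarith

lemma trim_kernel_measurable [measurable]: "trim_kernel G \<alpha> \<beta> \<in> borel_measurable borel"
  unfolding trim_kernel_eq_min[abs_def] by measurable

text \<open>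
  The two roundings change \<open>(\<beta> - \<alpha>) N\<close> by less than 1 altogether, so \<open>c n - 1 = O(1 / N)\<close>, and \<open>\<surd>n / N \<rightarrow> 0\<close>.
\<close>

lemma scaled_trim_ratio:
  assumes "1 \<le> m" and \<alpha>\<beta>: "0 \<le> \<alpha>" "\<alpha> < \<beta>"
  defines "c \<equiv> \<lambda>n. (\<beta> - \<alpha>) * real (n choose m) / (real (trim_index m n \<beta>) - real (trim_index m n \<alpha>))"
  shows "(\<lambda>n. sqrt (real n) * (c n - 1)) \<longlonglongrightarrow> 0"
    and "\<forall>\<^sub>F n in sequentially. \<bar>c n\<bar> \<le> 2"
proof -
  have "\<forall>\<^sub>F n in sequentially. 2 / (\<beta> - \<alpha>) \<le> real (n choose m)"
    using binomial_at_top[OF assms(1)] unfolding filterlim_at_top by blast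
  then have ev: "\<forall>\<^sub>F n in sequentially. \<bar>c n - 1\<bar> \<le> 2 / ((\<beta> - \<alpha>) * real (n choose m)) \<and> \<bar>c n - 1\<bar> \<le> 1"
  proof eventually_elim
    case (elim n)
    let ?N = "real (n choose m)"
    define d where "d = real (trim_index m n \<beta>) - real (trim_index m n \<alpha>)"
    have L: "2 \<le> (\<beta> - \<alpha>) * ?N" using elim \<alpha>\<beta> by (simp add: field_simps)
    have d: "\<bar>(\<beta> - \<alpha>) * ?N - d\<bar> \<le> 1"
      using trim_index_bounds[where \<gamma>=\<alpha> and m=m and n=n] trim_index_bounds[where \<gamma>=\<beta> and m=m and n=n] \<alpha>\<beta>
      unfolding d_def by (auto simp: algebra_simps)
    then have d_ge: "(\<beta> - \<alpha>) * ?N / 2 \<le> d" "1 \<le> d" using L by linarith+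
    have "c n - 1 = ((\<beta> - \<alpha>) * ?N - d) / d"
      unfolding c_def d_def[symmetric] using d_ge by (simp add: diff_divide_distrib)
    then have "\<bar>c n - 1\<bar> \<le> 1 / d"
      using d d_ge by (simp add: abs_divide divide_right_mono)
    moreover have "1 / d \<le> 1 / ((\<beta> - \<alpha>) * ?N / 2)"
      using d_ge L by (intro divide_left_mono mult_pos_pos) linarith+
    moreover have "1 / d \<le> 1" using d_ge by simp
    ultimately show ?case by simp
  qed
  then show "\<forall>\<^sub>F n in sequentially. \<bar>c n\<bar> \<le> 2"
    by (rule eventually_mono) linarith
  have lim: "(\<lambda>n. 2 / (\<beta> - \<alpha>) * (sqrt (real n) / real (n choose m))) \<longlonglongrightarrow> 0"
    using tendsto_mult_right_zero[OF sqrt_over_binomial_tendsto_0[OF assms(1)]] .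
  show "(\<lambda>n. sqrt (real n) * (c n - 1)) \<longlonglongrightarrow> 0"
  proof (rule Lim_null_comparison[OF _ lim])
    show "\<forall>\<^sub>F n in sequentially. norm (sqrt (real n) * (c n - 1)) \<le> 2 / (\<beta> - \<alpha>) * (sqrt (real n) / real (n choose m))"
      using ev
    proof eventually_elim
      case (elim n)
      then have "sqrt (real n) * \<bar>c n - 1\<bar> \<le> sqrt (real n) * (2 / ((\<beta> - \<alpha>) * real (n choose m)))"
        by (intro mult_left_mono) auto
      then show ?case by (simp add: abs_mult mult.commute)
    qed
  qed
qed

context symmetric_kernel_sample begin

lemma interval_measure_H: "interval_measure H = distr M borel (\<lambda>\<omega>. h (\<lambda>j\<in>{1..m}. X j \<omega>))"
proof -
  interpret D: real_distribution "distr M borel (\<lambda>\<omega>. h (\<lambda>j\<in>{1..m}. X j \<omega>))" by (rule real_distribution_H)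
  note H = D.cdf_nondecreasing D.cdf_is_right_cont D.cdf_lim_at_bot D.cdf_lim_at_top_prob
  show ?thesis
    unfolding kernel_cdf_def
    by (rule cdf_unique[OF real_distribution_interval_measure[OF H] real_distribution_H cdf_interval_measure[OF H(1-3)]])
qed

lemma theta_eq_expectation:
  "theta H \<alpha> \<beta> = (\<integral>\<omega>. trim_kernel H \<alpha> \<beta> (h (\<lambda>j\<in>{1..m}. X j \<omega>)) \<partial>M)"
  unfolding theta_def interval_measure_H
  by (rule integral_distr[OF h_sample_measurable trim_kernel_measurable])

lemma trimmed_U_measurable:
  assumes "\<alpha> \<le> \<beta>" "\<beta> \<le> 1"
  shows "(\<lambda>\<omega>. trimmed_U m h \<alpha> \<beta> n (\<lambda>i. X i \<omega>)) \<in> borel_measurable M"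
proof -
  have "\<alpha> \<le> 1" using assms by simp
  note [measurable] = partial_sum_measurable[OF \<open>\<alpha> \<le> 1\<close>] partial_sum_measurable[OF \<open>\<beta> \<le> 1\<close>]
  show ?thesis unfolding trimmed_U_eq_diff[OF assms(1)] by measurable
qed

text \<open>
  With \<open>V\<close> the U-statistic of the trimming kernel, \<open>E\<close> the linearization errors and \<open>c\<close> the ratio from
  \<open>scaled_trim_ratio\<close>, one has \<open>(\<beta> - \<alpha>) * trimmed_U = c * (V + E\<^sub>\<beta> - E\<^sub>\<alpha>)\<close>. Subtracting \<open>\<theta>\<close> and the projection
  from this leaves \<open>c * (E\<^sub>\<beta> - E\<^sub>\<alpha>) + (c - 1) * V\<close> plus the Hajek remainder, and each term is \<open>o\<^sub>P(n\<^sup>-\<^sup>1\<^sup>/\<^sup>2)\<close>.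
\<close>

lemma trimmed_U_asymptotically_normal:
  assumes \<alpha>\<beta>: "0 < \<alpha>" "\<alpha> < \<beta>" "\<beta> < 1"
    and cont: "isCont (quantile H) \<alpha>" "isCont (quantile H) \<beta>"
    and pos: "0 < sigma2_g M X m h \<alpha> \<beta>"
  shows "weak_conv_m
    (\<lambda>n. distr M borel (\<lambda>\<omega>. sqrt (real n) / real m * ((\<beta> - \<alpha>) * trimmed_U m h \<alpha> \<beta> n (\<lambda>i. X i \<omega>) - theta H \<alpha> \<beta>)))
    (density lborel (normal_density 0 (sqrt (sigma2_g M X m h \<alpha> \<beta>))))"
proof -
  define a where "a = xi_minus H \<alpha>"
  define b where "b = xi_minus H \<beta>"
  have \<alpha>1: "\<alpha> < 1" and \<beta>0: "0 < \<beta>" using \<alpha>\<beta> by simp_all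
  note qa = quantile_continuity_point[OF mono_H H_at_bot H_at_top \<alpha>\<beta>(1) \<alpha>1 cont(1)]
  note qb = quantile_continuity_point[OF mono_H H_at_bot H_at_top \<beta>0 \<alpha>\<beta>(3) cont(2)]
  define B where "B = \<bar>b - a\<bar> + \<bar>\<beta> * b\<bar> + \<bar>\<alpha> * a\<bar>"
  have T: "trim_kernel H \<alpha> \<beta> y = (min (y - b) 0 + \<beta> * b) - (min (y - a) 0 + \<alpha> * a)" for y
    by (simp add: trim_kernel_eq_min a_def b_def qa(1))
  interpret K: bounded_kernel M S F X m "\<lambda>x. trim_kernel H \<alpha> \<beta> (h x)" B
    by (rule bounded_transform) (use trim_kernel_bounded[of H \<alpha> \<beta>] in \<open>simp_all add: B_def a_def b_def qa(1)\<close>)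
  have \<theta>: "theta H \<alpha> \<beta> = K.kernel_mean"
    by (simp add: theta_eq_expectation K.kernel_mean_def)
  have g: "proj_g M X m h \<alpha> \<beta> x = K.kernel_proj x - K.kernel_mean" for x
    unfolding proj_g_def Let_def \<theta> K.kernel_proj_def kernel_section_def ..
  have \<sigma>: "sigma2_g M X m h \<alpha> \<beta> = (\<integral>\<omega>. (K.kernel_proj (X 0 \<omega>) - K.kernel_mean)\<^sup>2 \<partial>M)"
    by (simp add: sigma2_g_def g)
  define Y where "Y n \<omega> = (\<Sum>i=1..n. K.kernel_proj (X i \<omega>) - K.kernel_mean) / sqrt (real n)" for n \<omega>
  define D where "D n \<omega> = sqrt (real n) / real m * ((\<beta> - \<alpha>) * trimmed_U m h \<alpha> \<beta> n (\<lambda>i. X i \<omega>) - theta H \<alpha> \<beta>)" for n \<omega>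
  define Q\<alpha> where "Q\<alpha> n \<omega> = sqrt (real n) * linearization_error \<alpha> a n \<omega>" for n \<omega>
  define Q\<beta> where "Q\<beta> n \<omega> = sqrt (real n) * linearization_error \<beta> b n \<omega>" for n \<omega>
  define R where "R n \<omega> = sqrt (real n) * K.hajek_remainder n \<omega>" for n \<omega>
  define c where "c n = (\<beta> - \<alpha>) * real (n choose m) / (real (trim_index m n \<beta>) - real (trim_index m n \<alpha>))" for n
  \<comment> \<open>bounds \<open>\<bar>D n - Y n\<bar>\<close> as soon as \<open>\<bar>c n\<bar> \<le> 2\<close>\<close>
  define W where "W n \<omega> = (\<bar>R n \<omega>\<bar> + (\<bar>Q\<beta> n \<omega>\<bar> + \<bar>Q\<beta> n \<omega>\<bar>)) + ((\<bar>Q\<alpha> n \<omega>\<bar> + \<bar>Q\<alpha> n \<omega>\<bar>) + \<bar>sqrt (real n) * (c n - 1)\<bar> * B)" for n \<omega>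
  have Y_meas [measurable]: "Y n \<in> borel_measurable M" for n
    unfolding Y_def[abs_def] by measurable
  have D_meas [measurable]: "D n \<in> borel_measurable M" for n
    unfolding D_def[abs_def]
    by (intro borel_measurable_times borel_measurable_diff borel_measurable_const
        trimmed_U_measurable[OF less_imp_le[OF \<alpha>\<beta>(2)] less_imp_le[OF \<alpha>\<beta>(3)]])
  have R_meas [measurable]: "R n \<in> borel_measurable M" for n
    unfolding R_def[abs_def] by measurable
  have Q\<alpha>_meas [measurable]: "Q\<alpha> n \<in> borel_measurable M" for n
    using linearization_error_measurable[OF less_imp_le[OF \<alpha>1], of a n] unfolding Q\<alpha>_def[abs_def] by measurable
  have Q\<beta>_meas [measurable]: "Q\<beta> n \<in> borel_measurable M" for n
    using linearization_error_measurable[OF less_imp_le[OF \<alpha>\<beta>(3)], of b n] unfolding Q\<beta>_def[abs_def] by measurable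
  have W_meas [measurable]: "W n \<in> borel_measurable M" for n
    unfolding W_def[abs_def] by measurable
  have abs: "tends_to_zero_in_prob (\<lambda>n \<omega>. \<bar>V n \<omega>\<bar>)" if "tends_to_zero_in_prob V" for V
    using that by (simp add: tends_to_zero_in_prob_def)
  have R0: "tends_to_zero_in_prob R"
    unfolding R_def using K.scaled_hajek_remainder_negligible .
  have Q\<alpha>0: "tends_to_zero_in_prob Q\<alpha>"
    unfolding Q\<alpha>_def a_def by (rule linearization_error_negligible[OF \<alpha>\<beta>(1) \<alpha>1 qa(2,3)])
  have Q\<beta>0: "tends_to_zero_in_prob Q\<beta>"
    unfolding Q\<beta>_def b_def by (rule linearization_error_negligible[OF \<beta>0 \<alpha>\<beta>(3) qb(2,3)])
  note ratio = scaled_trim_ratio[OF m_pos less_imp_le[OF \<alpha>\<beta>(1)] \<alpha>\<beta>(2), folded c_def]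
  have c0: "tends_to_zero_in_prob (\<lambda>n _. \<bar>sqrt (real n) * (c n - 1)\<bar> * B)"
    by (rule tends_to_zero_in_prob_const, rule tendsto_mult_left_zero, rule tendsto_rabs_zero, rule ratio(1))
  have W0: "tends_to_zero_in_prob W"
    unfolding W_def by (intro tends_to_zero_in_prob_add abs R0 Q\<alpha>0 Q\<beta>0 c0) measurable
  have dom: "\<forall>\<^sub>F n in sequentially. \<forall>\<omega>\<in>space M. \<bar>D n \<omega> - Y n \<omega>\<bar> \<le> \<bar>W n \<omega>\<bar>"
    using ratio(2) eventually_ge_at_top[of m]
  proof eventually_elim
    case (elim n)
    define N where "N = real (n choose m)"
    have N0: "0 < N" and n0: "0 < real n" using elim m_pos by (simp_all add: N_def)
    show ?case
    proof
      fix \<omega>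
      let ?S = "\<lambda>\<gamma>. \<Sum>i<trim_index m n \<gamma>. order_stat n \<omega> i"
      let ?V = "K.U_stat n \<omega>" and ?E = "\<lambda>\<gamma> q. linearization_error \<gamma> q n \<omega>"
      let ?L = "\<lambda>q. \<Sum>I\<in>index_sets n m. min (sample_value \<omega> I - q) 0"
      define s where "s = (\<Sum>i=1..n. K.kernel_proj (X i \<omega>) - K.kernel_mean)"
      have "?V * N = (\<Sum>I\<in>index_sets n m. trim_kernel H \<alpha> \<beta> (sample_value \<omega> I))"
        using N0 by (simp add: K.U_stat_def N_def kernel_value_def)
      also have "\<dots> = (?L b + N * (\<beta> * b)) - (?L a + N * (\<alpha> * a))"
        unfolding T sum_subtractf sum.distrib sum_constant card_index_sets N_def ..
      finally have "?V = ((?L b + N * (\<beta> * b)) - (?L a + N * (\<alpha> * a))) / N"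
        using N0 by (simp add: eq_divide_eq)
      then have V: "?V = (\<beta> * b + ?L b / N) - (\<alpha> * a + ?L a / N)"
        using N0 by (simp add: add_divide_distrib diff_divide_distrib)
      have S: "(?S \<beta> - ?S \<alpha>) / N = ?V + ?E \<beta> b - ?E \<alpha> a"
        unfolding V linearization_error_def N_def[symmetric] by (simp add: diff_divide_distrib)
      have U: "(\<beta> - \<alpha>) * trimmed_U m h \<alpha> \<beta> n (\<lambda>i. X i \<omega>) = c n * (?V + ?E \<beta> b - ?E \<alpha> a)"
        unfolding S[symmetric] trimmed_U_eq_diff[OF less_imp_le[OF \<alpha>\<beta>(2)]] c_def N_def[symmetric]
        using N0 by simp
      have h: "K.hajek_remainder n \<omega> = ?V - K.kernel_mean - real m / real n * s"
        by (simp add: K.hajek_remainder_def s_def)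
      have Ys: "Y n \<omega> = sqrt (real n) / real m * (real m / real n * s)"
        using n0 m_pos unfolding Y_def s_def[symmetric]
        by (simp add: field_simps)
      have "D n \<omega> - Y n \<omega> = sqrt (real n) / real m *
          (c n * (?V + ?E \<beta> b - ?E \<alpha> a) - K.kernel_mean - real m / real n * s)"
        unfolding D_def U \<theta> Ys by (simp add: right_diff_distrib)
      also have "c n * (?V + ?E \<beta> b - ?E \<alpha> a) - K.kernel_mean - real m / real n * s
          = c n * (?E \<beta> b - ?E \<alpha> a) + (c n - 1) * ?V + K.hajek_remainder n \<omega>"
        unfolding h by (simp add: algebra_simps)
      also have "sqrt (real n) / real m * (c n * (?E \<beta> b - ?E \<alpha> a) + (c n - 1) * ?V + K.hajek_remainder n \<omega>)
          = (c n * Q\<beta> n \<omega> - c n * Q\<alpha> n \<omega> + sqrt (real n) * (c n - 1) * ?V + R n \<omega>) / real m"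
        by (simp add: Q\<alpha>_def Q\<beta>_def R_def algebra_simps add_divide_distrib diff_divide_distrib)
      finally have eq: "D n \<omega> - Y n \<omega> = (c n * Q\<beta> n \<omega> - c n * Q\<alpha> n \<omega> + sqrt (real n) * (c n - 1) * ?V + R n \<omega>) / real m" .
      have "\<bar>D n \<omega> - Y n \<omega>\<bar> \<le> \<bar>c n * Q\<beta> n \<omega> - c n * Q\<alpha> n \<omega> + sqrt (real n) * (c n - 1) * ?V + R n \<omega>\<bar>"
        unfolding eq abs_divide using m_pos by (simp add: divide_le_eq mult_left_le mult_le_cancel_left1)
      also have "\<dots> \<le> \<bar>c n * Q\<beta> n \<omega>\<bar> + \<bar>c n * Q\<alpha> n \<omega>\<bar> + \<bar>sqrt (real n) * (c n - 1) * ?V\<bar> + \<bar>R n \<omega>\<bar>"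
        by linarith
      also have "\<bar>c n * Q\<beta> n \<omega>\<bar> \<le> 2 * \<bar>Q\<beta> n \<omega>\<bar>"
        unfolding abs_mult using elim by (intro mult_right_mono) auto
      also have "\<bar>c n * Q\<alpha> n \<omega>\<bar> \<le> 2 * \<bar>Q\<alpha> n \<omega>\<bar>"
        unfolding abs_mult using elim by (intro mult_right_mono) auto
      also have "\<bar>sqrt (real n) * (c n - 1) * ?V\<bar> \<le> \<bar>sqrt (real n) * (c n - 1)\<bar> * B"
        unfolding abs_mult[of _ ?V] by (intro mult_left_mono K.U_stat_bounded) simp
      finally show "\<bar>D n \<omega> - Y n \<omega>\<bar> \<le> \<bar>W n \<omega>\<bar>"
        unfolding W_def by linarith
    qed
  qed
  have Z0: "tends_to_zero_in_prob (\<lambda>n \<omega>. D n \<omega> - Y n \<omega>)"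
    by (rule tends_to_zero_in_prob_dominated[OF W0 W_meas dom])
  have "weak_conv_m (\<lambda>n. distr M borel (\<lambda>\<omega>. Y n \<omega> + (D n \<omega> - Y n \<omega>)))
      (density lborel (normal_density 0 (sqrt (sigma2_g M X m h \<alpha> \<beta>))))"
  proof (rule slutsky_add[OF Y_meas _ _ _ Z0])
    show "real_distribution (density lborel (normal_density 0 (sqrt (sigma2_g M X m h \<alpha> \<beta>))))"
      using pos by (intro real_distribution_normal) simp
    show "(\<lambda>n. char (distr M borel (Y n)) t)
        \<longlonglongrightarrow> char (density lborel (normal_density 0 (sqrt (sigma2_g M X m h \<alpha> \<beta>)))) t" for t
      using K.projection_clt[of t] pos unfolding \<sigma> Y_def by simp
  qed measurable
  then show ?thesis by (simp add: D_def)
qed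

end

theorem corollary1p3:
  fixes M :: "'b measure" and S F :: "'a measure" and X :: "nat \<Rightarrow> 'b \<Rightarrow> 'a"
    and m :: nat and h :: "(nat \<Rightarrow> 'a) \<Rightarrow> real" and \<alpha> \<beta> :: real
  assumes "prob_space M"
    and "prob_space.indep_vars M (\<lambda>_. S) X UNIV"
    and "\<And>i. distr M S (X i) = F"
    and "m \<ge> 1"
    and "h \<in> borel_measurable (\<Pi>\<^sub>M j\<in>{1..m}. S)"
    and "symmetric_kernel S m h"
    and "0 < \<alpha>" and "\<alpha> < \<beta>" and "\<beta> < 1"
    and "isCont (quantile (kernel_cdf M X m h)) \<alpha>"
    and "isCont (quantile (kernel_cdf M X m h)) \<beta>"
    and "sigma2_g M X m h \<alpha> \<beta> > 0"
  shows "weak_conv_m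
           (\<lambda>n. distr M borel (\<lambda>\<omega>. sqrt (real n) / real m *
              ((\<beta> - \<alpha>) * trimmed_U m h \<alpha> \<beta> n (\<lambda>i. X i \<omega>) - theta (kernel_cdf M X m h) \<alpha> \<beta>)))
           (density lborel (normal_density 0 (sqrt (sigma2_g M X m h \<alpha> \<beta>))))"
proof -
  interpret prob_space M by fact
  interpret symmetric_kernel_sample M S F X m h
    by unfold_locales (use assms in auto)
  show ?thesis
    by (rule trimmed_U_asymptotically_normal) (use assms in auto)
qed

end
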